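(* Let $n>1$ and let $K$ be a closed subgroup of $O(n)$ that is transitive on the spheres about $0$ in $\mathbb{R}^n$. Let $G=\mathbb{R}^n\cdot K$ be the semidirect product and $\mathbb{E}^n=G/K$. Then the $(G,K)$-spherical functions on $\mathbb{E}^n$ are parametrized by $\mathbb{C}$, and the positive definite spherical functions are the ones with real non-negative parameter. Here $\varphi_\xi^K$ $(\xi\in\mathbb{C}^n)$ has parameter $b(\xi,\xi)$, which is its $\Delta$-eigenvalue, and (given $n$) $\varphi_\xi^K$ is the same for any choice of group $K$, transitive on the spheres about $0$ in $\mathbb{R}^n$, in the following list: - $n>1$ and $K=SO(n)$ or $O(n)$; - $n=2m$ and $K=SU(m)$ or $U(m)$; - $n=4m$ and $K=Sp(m)$ or $Sp(m)\cdot U(1)$ or $Sp(m)\cdot Sp(1)$; - $n=7$ and $K$ is the exceptional group $G_2$; - $n=8$ and $K=Spin(7)$; - $n=16$ and $K=Spin(9)$. Further, $$\varphi_\xi^K(x)=2^{(n-2)/2}\,\Gamma(\tfrac n2)\,(\|\xi\|r)^{-(n-2)/2}J_{(n-2)/2}(\|\xi\|r)=\frac{\pi^{-1/2}\,\Gamma(\frac n2)}{\Gamma(\frac{n-1}2)}\int_0^\pi\cos\bigl(\sqrt{b(\xi,\xi)}\,\|x\|\cos\theta\bigr)\sin^{n-2}\theta\,d\theta,$$ where $\|\xi\|=\sqrt{b(\xi,\xi)}$, $r=\|x\|=\sqrt{b(x,x)}$ and $J_\nu$ is the Bessel function of the first kind of order $\nu$.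
   Context: $b$ is the $\mathbb{C}$-bilinear form on $\mathbb{C}^n$ extending the standard inner product of $\mathbb{R}^n$; $K$ acts on $\mathbb{C}^n$ by complexification of its action on $\mathbb{R}^n$. $\mathbb{E}^n=G/K$ is identified with $\mathbb{R}^n$. For $\xi\in\mathbb{C}^n$, $\varphi_\xi^K(x)=\int_K e^{i\,b(x,k(\xi))}\,d\mu_K(k)$, with $\mu_K$ the Haar measure on $K$ of total mass $1$; these (lifted to $G$) are $(G,K)$-spherical. "Parametrized by $\mathbb{C}$, with $\varphi_\xi^K$ having parameter $b(\xi,\xi)$" means that every $(G,K)$-spherical function is some $\varphi_\xi^K$ and $\varphi_\xi^K\mapsto b(\xi,\xi)$ is a well-defined bijection onto $\mathbb{C}$. $\Delta=-\sum_i\partial^2/\partial x_i^2$. A function $\varphi:G\to\mathbb{C}$ is $(G,K)$-spherical if it is continuous, bi-$K$-invariant, $\varphi(1)=1$, and for every continuous compactly supported bi-$K$-invariant function $f$ on $G$ there is $\lambda_f\in\mathbb{C}$ with $f*\varphi=\lambda_f\varphi$. Right-$K$-invariant functions on $G$ are identified with functions on $\mathbb{E}^n$. It is positive definite if $\sum_{i,j}\varphi(g_j^{-1}g_i)\overline{c_j}c_i\ge0$ for all finite families $c_i\in\mathbb{C}$, $g_i\in G$. Either square root of $b(\xi,\xi)$ may be used, since $t^{-\nu}J_\nu(t)$ extends to an even entire function of $t$; at $t=0$ it is understood as the value of that extension. The groups in the list act on $\mathbb{R}^n$ by their usual representations: $SU(m),U(m)$ on $\mathbb{C}^m=\mathbb{R}^{2m}$;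 $Sp(m)$, $Sp(m)\cdot U(1)$, $Sp(m)\cdot Sp(1)$ on $\mathbb{H}^m=\mathbb{R}^{4m}$ ($Sp(m)$ by quaternion-linear isometries, and $U(1)\subset Sp(1)$, $Sp(1)$ by unit quaternion scalars on the other side); $G_2$ on $\mathbb{R}^7$ (imaginary octonions); $Spin(7)$ on $\mathbb{R}^8$ and $Spin(9)$ on $\mathbb{R}^{16}$ by the spin representations. *)

theory Defs
  imports "HOL-Analysis.Analysis" "HOL-Algebra.Group"
begin

section \<open>The groups \<open>K\<close> and \<open>G = \<real>\<^sup>n \<cdot> K\<close>\<close>

definition orthogonal_group :: "(real^'n^'n) monoid" where
  "orthogonal_group = \<lparr>carrier = {A. orthogonal_matrix A}, mult = (**), one = mat 1\<rparr>"

definition transitive_on_spheres :: "(real^'n^'n) set \<Rightarrow> bool" where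
  "transitive_on_spheres K \<longleftrightarrow> (\<forall>x y. norm x = norm y \<longrightarrow> (\<exists>k\<in>K. k *v x = y))"

text \<open>The pair \<open>(x, k)\<close> is the motion \<open>y \<mapsto> x + k y\<close>. Functions on the motion group are total HOL
  functions of which only the values on the carrier matter; the topology of the group is the one
  induced from the ambient space of pairs.\<close>

definition motion_group ::
  "(real^'n^'n) set \<Rightarrow> ((real^'n) \<times> (real^'n^'n)) monoid" where
  "motion_group K =
     \<lparr>carrier = UNIV \<times> K,
      mult = (\<lambda>(x, k) (y, l). (x + k *v y, k ** l)),
      one = (0, mat 1)\<rparr>"

text \<open>Haar measure of total mass 1 on \<open>K\<close>; the condition on \<open>sets\<close> forces \<open>space \<mu> = K\<close>.\<close>

definition haar_probability :: "(real^'n^'n) set \<Rightarrow> (real^'n^'n) measure \<Rightarrow> bool" where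
  "haar_probability K \<mu> \<longleftrightarrow>
     sets \<mu> = sets (restrict_space borel K) \<and>
     emeasure \<mu> K = 1 \<and>
     (\<forall>k\<in>K. distr \<mu> \<mu> (\<lambda>l. k ** l) = \<mu>)"


section \<open>Spherical functions for \<open>(G, K)\<close>\<close>

definition bi_invariant ::
  "(real^'n^'n) set \<Rightarrow> ((real^'n) \<times> (real^'n^'n) \<Rightarrow> complex) \<Rightarrow> bool" where
  "bi_invariant K f \<longleftrightarrow>
     (\<forall>g \<in> carrier (motion_group K). \<forall>k\<in>K. \<forall>l\<in>K.
        f ((0, k) \<otimes>\<^bsub>motion_group K\<^esub> g \<otimes>\<^bsub>motion_group K\<^esub> (0, l)) = f g)"

definition compactly_supported ::
  "(real^'n^'n) set \<Rightarrow> ((real^'n) \<times> (real^'n^'n) \<Rightarrow> complex) \<Rightarrow> bool" where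
  "compactly_supported K f \<longleftrightarrow>
     (\<exists>C. compact C \<and> C \<subseteq> carrier (motion_group K) \<and>
          (\<forall>g \<in> carrier (motion_group K) - C. f g = 0))"

text \<open>Lebesgue measure times the Haar measure of \<open>K\<close> is a left (and right) Haar measure on the
  motion group, because orthogonal maps and translations preserve Lebesgue measure.\<close>

definition convolution ::
  "(real^'n^'n) set \<Rightarrow> (real^'n^'n) measure \<Rightarrow> ((real^'n) \<times> (real^'n^'n) \<Rightarrow> complex) \<Rightarrow>
   ((real^'n) \<times> (real^'n^'n) \<Rightarrow> complex) \<Rightarrow> (real^'n) \<times> (real^'n^'n) \<Rightarrow> complex" where
  "convolution K \<mu> f \<phi> g =
     (\<integral>h. f h * \<phi> (inv\<^bsub>motion_group K\<^esub> h \<otimes>\<^bsub>motion_group K\<^esub> g) \<partial>(lborel \<Otimes>\<^sub>M \<mu>))"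

definition spherical ::
  "(real^'n^'n) set \<Rightarrow> (real^'n^'n) measure \<Rightarrow> ((real^'n) \<times> (real^'n^'n) \<Rightarrow> complex) \<Rightarrow> bool"
  where
  "spherical K \<mu> \<phi> \<longleftrightarrow>
     continuous_on (carrier (motion_group K)) \<phi> \<and>
     bi_invariant K \<phi> \<and>
     \<phi> \<one>\<^bsub>motion_group K\<^esub> = 1 \<and>
     (\<forall>f. continuous_on (carrier (motion_group K)) f \<and> compactly_supported K f \<and>
          bi_invariant K f \<longrightarrow>
        (\<exists>ev. \<forall>g \<in> carrier (motion_group K). convolution K \<mu> f \<phi> g = ev * \<phi> g))"

definition positive_definite :: "'g monoid \<Rightarrow> ('g \<Rightarrow> complex) \<Rightarrow> bool" where
  "positive_definite G \<phi> \<longleftrightarrow>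
     (\<forall>(N::nat) g c. (\<forall>i<N. g i \<in> carrier G) \<longrightarrow>
        (\<Sum>i<N. \<Sum>j<N. \<phi> (inv\<^bsub>G\<^esub> (g j) \<otimes>\<^bsub>G\<^esub> g i) * cnj (c j) * c i) \<in> \<real>\<^sub>\<ge>\<^sub>0)"

text \<open>The identification of functions on \<open>\<real>\<^sup>n = G/K\<close> with right \<open>K\<close>-invariant functions on \<open>G\<close>.\<close>

definition lift :: "(real^'n \<Rightarrow> complex) \<Rightarrow> (real^'n) \<times> (real^'n^'n) \<Rightarrow> complex" where
  "lift \<psi> g = \<psi> (fst g)"

definition spherical_functions ::
  "(real^'n^'n) set \<Rightarrow> (real^'n^'n) measure \<Rightarrow> (real^'n \<Rightarrow> complex) set" where
  "spherical_functions K \<mu> = {\<psi>. spherical K \<mu> (lift \<psi>)}"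


section \<open>The functions \<open>\<phi>\<^sub>\<xi>\<close>\<close>

definition bform :: "complex^'n \<Rightarrow> complex^'n \<Rightarrow> complex" where
  "bform \<xi> \<eta> = (\<Sum>i\<in>UNIV. \<xi> $ i * \<eta> $ i)"

definition cvec :: "real^'n \<Rightarrow> complex^'n" where
  "cvec x = (\<chi> i. complex_of_real (x $ i))"

definition cmat :: "real^'n^'n \<Rightarrow> complex^'n^'n" where
  "cmat k = (\<chi> i j. complex_of_real (k $ i $ j))"

definition phi :: "(real^'n^'n) measure \<Rightarrow> complex^'n \<Rightarrow> real^'n \<Rightarrow> complex" where
  "phi \<mu> \<xi> x = (\<integral>k. exp (\<i> * bform (cvec x) (cmat k *v \<xi>)) \<partial>\<mu>)"

text \<open>\<open>has_Delta f x L\<close>: the first partial derivatives \<open>D i\<close> of \<open>f\<close> exist everywhere, the second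
  pure partial derivatives exist at \<open>x\<close>, and minus their sum is \<open>L\<close>.\<close>

definition has_Delta :: "(real^'n \<Rightarrow> complex) \<Rightarrow> real^'n \<Rightarrow> complex \<Rightarrow> bool" where
  "has_Delta f x L \<longleftrightarrow>
     (\<exists>D H.
        (\<forall>i y. ((\<lambda>t. f (y + t *\<^sub>R axis i 1)) has_vector_derivative D i y) (at 0)) \<and>
        (\<forall>i. ((\<lambda>t. D i (x + t *\<^sub>R axis i 1)) has_vector_derivative H i) (at 0)) \<and>
        L = - (\<Sum>i\<in>UNIV. H i))"

text \<open>Principal branch, order \<open>\<nu> \<ge> 0\<close>. The case distinction is needed because \<open>0 powr 0 = 0\<close>,
  whereas \<open>J\<^sub>0(0) = 1\<close>.\<close>

definition bessel_J :: "real \<Rightarrow> complex \<Rightarrow> complex" where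
  "bessel_J \<nu> t =
     (if t = 0 \<and> \<nu> = 0 then 1 else (t / 2) powr complex_of_real \<nu>) *
     (\<Sum>k. complex_of_real ((-1) ^ k / (fact k * Gamma (\<nu> + real k + 1))) * (t / 2) ^ (2 * k))"

text \<open>The entire function \<open>t\<^sup>-\<^sup>\<nu> J\<^sub>\<nu>(t)\<close>, with the removable singularity at 0 filled in.\<close>

definition bessel_J_quot :: "real \<Rightarrow> complex \<Rightarrow> complex" where
  "bessel_J_quot \<nu> t =
     (if t = 0 then Lim (at 0) (\<lambda>s. s powr complex_of_real (- \<nu>) * bessel_J \<nu> s)
      else t powr complex_of_real (- \<nu>) * bessel_J \<nu> t)"


section \<open>The list of groups\<close>

text \<open>Quaternions \<open>a + b j\<close> as pairs \<open>(a, b)\<close> of complex numbers, and octonions as pairs of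
  quaternions (Cayley--Dickson). The product norm is the quaternion, resp. octonion, norm.\<close>

type_synonym quat = "complex \<times> complex"
type_synonym oct = "quat \<times> quat"

definition qmult :: "quat \<Rightarrow> quat \<Rightarrow> quat" where
  "qmult p q = (fst p * fst q - snd p * cnj (snd q), fst p * snd q + snd p * cnj (fst q))"

definition qcnj :: "quat \<Rightarrow> quat" where
  "qcnj p = (cnj (fst p), - snd p)"

definition omult :: "oct \<Rightarrow> oct \<Rightarrow> oct" where
  "omult u v =
     (qmult (fst u) (fst v) - qmult (qcnj (snd v)) (snd u),
      qmult (snd v) (fst u) + qmult (snd u) (qcnj (fst v)))"

definition imaginary_oct :: "oct set" where
  "imaginary_oct = {u. Re (fst (fst u)) = 0}"

text \<open>A linear isometry of \<open>\<real>\<^sup>n\<close> with \<open>\<complex>\<^sup>m\<close> or \<open>\<bbbH>\<^sup>m\<close>, given by its coordinates with indices below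
  \<open>m\<close>; it is onto by dimension. As \<open>m\<close> depends on \<open>n\<close>, the entries of \<open>m\<close>-vectors and
  \<open>m \<times> m\<close> matrices are indexed by natural numbers below \<open>m\<close>.\<close>

definition coordinates :: "nat \<Rightarrow> (real^'n \<Rightarrow> nat \<Rightarrow> 'a::euclidean_space) \<Rightarrow> bool" where
  "coordinates m T \<longleftrightarrow>
     CARD('n) = m * DIM('a) \<and>
     (\<forall>j<m. linear (\<lambda>x. T x j)) \<and>
     (\<forall>x. (norm x)\<^sup>2 = (\<Sum>j<m. (norm (T x j))\<^sup>2))"

definition unitary_entries :: "nat \<Rightarrow> (nat \<Rightarrow> nat \<Rightarrow> complex) \<Rightarrow> bool" where
  "unitary_entries m u \<longleftrightarrow>
     (\<forall>i<m. \<forall>j<m. (\<Sum>k<m. u i k * cnj (u j k)) = (if i = j then 1 else 0))"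

definition det_entries :: "nat \<Rightarrow> (nat \<Rightarrow> nat \<Rightarrow> complex) \<Rightarrow> complex" where
  "det_entries m u = (\<Sum>p | p permutes {..<m}. of_int (sign p) * (\<Prod>i<m. u i (p i)))"

definition SO_group :: "(real^'n^'n) set" where
  "SO_group = {A. orthogonal_matrix A \<and> det A = 1}"

definition O_group :: "(real^'n^'n) set" where
  "O_group = {A. orthogonal_matrix A}"

definition U_group :: "nat \<Rightarrow> (real^'n \<Rightarrow> nat \<Rightarrow> complex) \<Rightarrow> (real^'n^'n) set" where
  "U_group m T =
     {A. \<exists>u. unitary_entries m u \<and> (\<forall>x. \<forall>i<m. T (A *v x) i = (\<Sum>k<m. u i k * T x k))}"

definition SU_group :: "nat \<Rightarrow> (real^'n \<Rightarrow> nat \<Rightarrow> complex) \<Rightarrow> (real^'n^'n) set" where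
  "SU_group m T =
     {A. \<exists>u. unitary_entries m u \<and> det_entries m u = 1 \<and>
             (\<forall>x. \<forall>i<m. T (A *v x) i = (\<Sum>k<m. u i k * T x k))}"

definition symplectic_entries :: "nat \<Rightarrow> (nat \<Rightarrow> nat \<Rightarrow> quat) \<Rightarrow> bool" where
  "symplectic_entries m q \<longleftrightarrow>
     (\<forall>i<m. \<forall>j<m. (\<Sum>k<m. qmult (q i k) (qcnj (q j k))) = (if i = j then (1, 0) else 0))"

text \<open>\<open>Sp(m) \<cdot> S\<close> for a group \<open>S\<close> of unit quaternions: matrices act on the left of column vectors,
  scalars on the right.\<close>

definition Sp_times :: "quat set \<Rightarrow> nat \<Rightarrow> (real^'n \<Rightarrow> nat \<Rightarrow> quat) \<Rightarrow> (real^'n^'n) set" where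
  "Sp_times S m T =
     {A. \<exists>q. \<exists>s\<in>S. symplectic_entries m q \<and>
            (\<forall>x. \<forall>i<m. T (A *v x) i = qmult (\<Sum>k<m. qmult (q i k) (T x k)) s)}"

definition unit_quats :: "quat set" where
  "unit_quats = {s. norm s = 1}"

definition unit_complex_quats :: "quat set" where
  "unit_complex_quats = {s. norm s = 1 \<and> snd s = 0}"

text \<open>\<open>G\<^sub>2\<close> is the automorphism group of the octonion algebra, acting on the imaginary octonions.\<close>

definition G2_group :: "(real^'n \<Rightarrow> oct) \<Rightarrow> (real^'n^'n) set" where
  "G2_group T =
     {A. \<exists>\<sigma>. linear \<sigma> \<and> bij \<sigma> \<and> (\<forall>u v. \<sigma> (omult u v) = omult (\<sigma> u) (\<sigma> v)) \<and>
             (\<forall>x. T (A *v x) = \<sigma> (T x))}"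

text \<open>An orthogonal Clifford module: \<open>c(v)\<^sup>2 = \<epsilon> |v|\<^sup>2\<close>, unit vectors acting orthogonally. The group
  \<open>Spin(d)\<close> consists of the even products of unit vectors in the Clifford algebra; up to
  isomorphism it does not depend on the sign \<open>\<epsilon> = \<plusminus> 1\<close>. The Clifford algebra with \<open>d = 7\<close>, \<open>\<epsilon> = -1\<close>
  has modules of dimension 8, the one with \<open>d = 9\<close>, \<open>\<epsilon> = 1\<close> has modules of dimension 16; these
  are irreducible and restrict to the real spin representation of \<open>Spin(7)\<close>, resp. \<open>Spin(9)\<close>.\<close>

definition clifford_module :: "real \<Rightarrow> (real^'d \<Rightarrow> real^'n^'n) \<Rightarrow> bool" where
  "clifford_module \<epsilon> c \<longleftrightarrow>
     linear c \<and>
     (\<forall>v. c v ** c v = (\<epsilon> * (norm v)\<^sup>2) *\<^sub>R mat 1) \<and>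
     (\<forall>v. norm v = 1 \<longrightarrow> orthogonal_matrix (c v))"

inductive_set spin_image :: "(real^'d \<Rightarrow> real^'n^'n) \<Rightarrow> (real^'n^'n) set"
  for c :: "real^'d \<Rightarrow> real^'n^'n" where
  one: "mat 1 \<in> spin_image c"
| step: "A \<in> spin_image c \<Longrightarrow> norm u = 1 \<Longrightarrow> norm v = 1 \<Longrightarrow> A ** (c u ** c v) \<in> spin_image c"

text \<open>The usual representations are taken up to linear isometry, so every identification of
  \<open>\<real>\<^sup>n\<close> with the space on which the group acts is admitted.\<close>

definition listed :: "(real^'n^'n) set \<Rightarrow> bool" where
  "listed K \<longleftrightarrow>
     CARD('n) > 1 \<and> (K = SO_group \<or> K = O_group)
   \<or> (\<exists>m T. CARD('n) = 2 * m \<and> coordinates m T \<and> (K = SU_group m T \<or> K = U_group m T))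
   \<or> (\<exists>m T. CARD('n) = 4 * m \<and> coordinates m T \<and>
        (K = Sp_times {(1, 0)} m T \<or> K = Sp_times unit_complex_quats m T \<or>
         K = Sp_times unit_quats m T))
   \<or> CARD('n) = 7 \<and>
       (\<exists>T. linear T \<and> (\<forall>x. norm (T x) = norm x) \<and> range T = imaginary_oct \<and> K = G2_group T)
   \<or> CARD('n) = 8 \<and> (\<exists>c :: real^7 \<Rightarrow> real^'n^'n. clifford_module (-1) c \<and> K = spin_image c)
   \<or> CARD('n) = 16 \<and> (\<exists>c :: real^9 \<Rightarrow> real^'n^'n. clifford_module 1 c \<and> K = spin_image c)"

end

theory Submission
  imports Defs "HOL-Probability.Probability_Measure"
begin

text \<open>Put \<open>h\<^sub>\<beta>(x) = \<^sub>0F\<^sub>1(n/2; - \<beta> |x|\<^sup>2 / 4)\<close>. It satisfies \<open>\<Delta> h\<^sub>\<beta> = \<beta> h\<^sub>\<beta>\<close>, and it is the only radial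
  eigenfunction with eigenvalue \<open>\<beta>\<close> and value 1 at 0, because on a ray the equation is a singular ODE whose
  energy cannot leave 0. Differentiating under the integral shows \<open>\<phi>\<^sub>\<xi> = h\<^sub>\<beta>\<close> with \<open>\<beta> = b(\<xi>, \<xi>)\<close>
  for every transitive \<open>K\<close>; Fubini shows that \<open>\<phi>\<^sub>\<xi>\<close> is spherical. Conversely a spherical function is radial, and
  convolution with a radial \<open>C\<^sup>2\<close> bump and with the Laplacian of that bump makes it an eigenfunction of
  \<open>\<Delta>\<close>. For \<open>\<beta> \<ge> 0\<close> the vector \<open>\<xi>\<close> may be taken real, and \<open>\<phi>\<^sub>\<xi>\<close> is an average of characters;
  conversely a positive definite even function is real and at most 1, whereas \<open>h\<^sub>\<beta>\<close> is not real
  for \<open>\<beta> \<notin> \<real>\<close> and exceeds 1 for \<open>\<beta> < 0\<close>. The Bessel formula and the Poisson integral are read off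
  the power series.\<close>

section \<open>The hypergeometric function \<open>\<^sub>0F\<^sub>1\<close>\<close>

text \<open>Everything is compared with one explicit family because a direct comparison is not at
  hand: a spherical function is a priori only continuous, and \<open>phi\<close> is an integral over
  a group known only through its orbits. A series in |x|^2 avoids both a choice of square root of
  \<beta> and the singularity of polar coordinates at 0; its index n/2 is at least 1 because n > 1.
  The predicate \<open>has_Delta\<close> speaks of partial derivatives along coordinate lines only,
  so all differentiation happens in one real variable and joint smoothness is never assumed. As the
  functions of the family are 1 at 0, their parameter can be recovered as the value of \<Delta>
  there; this makes the parametrization injective.\<close>

definition hyp0F1_coeff :: "real \<Rightarrow> nat \<Rightarrow> complex" where
  "hyp0F1_coeff c j = complex_of_real (1 / (fact j * pochhammer c j))"

definition hyp0F1 :: "real \<Rightarrow> complex \<Rightarrow> complex" where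
  "hyp0F1 c s = (\<Sum>j. hyp0F1_coeff c j * s ^ j)"

definition hyp0F1' :: "real \<Rightarrow> complex \<Rightarrow> complex" where
  "hyp0F1' c s = (\<Sum>j. diffs (hyp0F1_coeff c) j * s ^ j)"

definition hyp0F1'' :: "real \<Rightarrow> complex \<Rightarrow> complex" where
  "hyp0F1'' c s = (\<Sum>j. diffs (diffs (hyp0F1_coeff c)) j * s ^ j)"

lemma pochhammer_ge_1:
  fixes c :: real
  assumes "c \<ge> 1"
  shows "pochhammer c j \<ge> 1"
proof (induction j)
  case (Suc j)
  have "1 * 1 \<le> pochhammer c j * (c + real j)"
    using Suc assms by (intro mult_mono) auto
  then show ?case by (simp add: pochhammer_Suc)
qed simp

text \<open>The Pochhammer symbols are at least 1, so the exponential series is a majorant for every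
  \<open>s\<close>.\<close>

lemma summable_hyp0F1_coeff:
  assumes "c \<ge> 1"
  shows "summable (\<lambda>j. hyp0F1_coeff c j * s ^ j)"
proof (rule summable_comparison_test')
  show "summable (\<lambda>j. norm s ^ j /\<^sub>R fact j)"
    by (rule summable_exp_generic)
  fix j :: nat assume "j \<ge> 0"
  have p: "pochhammer c j \<ge> 1" by (rule pochhammer_ge_1[OF assms])
  have "norm (hyp0F1_coeff c j) \<le> 1 / fact j"
    using p mult_mono[of "fact j" "fact j" 1 "pochhammer c j"]
    by (simp add: hyp0F1_coeff_def norm_divide norm_mult frac_le del: of_real_mult)
  then have "norm (hyp0F1_coeff c j) * norm s ^ j \<le> 1 / fact j * norm s ^ j"
    by (rule mult_right_mono) simp
  then show "norm (hyp0F1_coeff c j * s ^ j) \<le> norm s ^ j /\<^sub>R fact j"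
    by (simp add: norm_mult norm_power divide_inverse_commute)
qed

lemma summable_diffs_everywhere:
  fixes a :: "nat \<Rightarrow> complex"
  assumes "\<And>s. summable (\<lambda>j. a j * s ^ j)"
  shows "summable (\<lambda>j. diffs a j * s ^ j)"
  by (rule termdiff_converges_all) (rule assms)

lemma has_field_derivative_hyp0F1:
  assumes "c \<ge> 1"
  shows "(hyp0F1 c has_field_derivative hyp0F1' c s) (at s)"
  unfolding hyp0F1_def[abs_def] hyp0F1'_def
  by (rule termdiffs_strong_converges_everywhere) (rule summable_hyp0F1_coeff[OF assms])

lemma has_field_derivative_hyp0F1':
  assumes "c \<ge> 1"
  shows "(hyp0F1' c has_field_derivative hyp0F1'' c s) (at s)"
  unfolding hyp0F1'_def[abs_def] hyp0F1''_def
  by (intro termdiffs_strong_converges_everywhere summable_diffs_everywhere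
      summable_hyp0F1_coeff[OF assms])

lemma hyp0F1_0 [simp]: "hyp0F1 c 0 = 1"
  unfolding hyp0F1_def by (subst suminf_finite[of "{0}"]) (auto simp: hyp0F1_coeff_def)

text \<open>The coefficients satisfy (j+1)(c+j) a_(j+1) = a_j, which is the equation read
  coefficient by coefficient.\<close>

lemma hyp0F1_ode:
  assumes "c \<ge> 1"
  shows "s * hyp0F1'' c s + complex_of_real c * hyp0F1' c s = hyp0F1 c s"
proof -
  let ?a = "hyp0F1_coeff c"
  have s0: "summable (\<lambda>j. ?a j * s ^ j)" for s by (rule summable_hyp0F1_coeff[OF assms])
  have s1: "summable (\<lambda>j. diffs ?a j * s ^ j)" for s
    by (intro summable_diffs_everywhere s0)
  have s2: "summable (\<lambda>j. diffs (diffs ?a) j * s ^ j)" for s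
    by (intro summable_diffs_everywhere s1)
  \<comment> \<open>Multiplication by \<open>s\<close> raises the index by one; the term at index 0
    carries the factor 0, so the sum may start there.\<close>
  have shift: "(\<lambda>j. of_nat j * diffs ?a j * s ^ j) sums (s * hyp0F1'' c s)"
  proof -
    have "(\<lambda>j. s * (diffs (diffs ?a) j * s ^ j)) sums (s * hyp0F1'' c s)"
      unfolding hyp0F1''_def by (intro sums_mult summable_sums s2)
    then have "(\<lambda>j. of_nat (Suc j) * diffs ?a (Suc j) * s ^ Suc j) sums (s * hyp0F1'' c s)"
      by (simp add: diffs_def mult_ac)
    then show ?thesis
      using sums_Suc_iff[of "\<lambda>j. of_nat j * diffs ?a j * s ^ j"] by simp
  qed
  have "(\<lambda>j. of_nat j * diffs ?a j * s ^ j + complex_of_real c * (diffs ?a j * s ^ j))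
      sums (s * hyp0F1'' c s + complex_of_real c * hyp0F1' c s)"
    unfolding hyp0F1'_def by (intro sums_add shift sums_mult summable_sums s1)
  moreover have "of_nat j * diffs ?a j * s ^ j + complex_of_real c * (diffs ?a j * s ^ j) = ?a j * s ^ j"
    for j
  proof -
    have "pochhammer c j > 0" "c + real j > 0" using pochhammer_ge_1[OF assms, of j] assms by auto
    then have "real (Suc j) * (c + real j) * (1 / (fact (Suc j) * pochhammer c (Suc j)))
      = 1 / (fact j * pochhammer c j)"
    proof -
      have "A * B * (1 / ((A * F) * (P * B))) = 1 / (F * P)" if "A \<noteq> 0" "B \<noteq> 0" for A B F P :: real
        using that by simp
      from this[of "real (Suc j)" "c + real j" "fact j" "pochhammer c j"] show ?thesis
        using \<open>c + real j > 0\<close> by (simp add: pochhammer_Suc)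
    qed
    then have "complex_of_real (real (Suc j) * (c + real j) * (1 / (fact (Suc j) * pochhammer c (Suc j))))
      = ?a j" by (simp only: hyp0F1_coeff_def)
    then have eq: "of_nat (Suc j) * (complex_of_real c + of_nat j) * ?a (Suc j) = ?a j"
      by (simp only: hyp0F1_coeff_def of_real_mult of_real_add of_real_of_nat_eq)
    show ?thesis
      unfolding eq[symmetric] by (simp add: diffs_def algebra_simps)
  qed
  ultimately show ?thesis
    unfolding hyp0F1_def using sums_unique by fastforce
qed

lemma continuous_on_hyp0F1:
  assumes "c \<ge> 1"
  shows "continuous_on A (hyp0F1 c)"
  by (meson DERIV_continuous_on DERIV_subset assms has_field_derivative_hyp0F1 top_greatest)

section \<open>Radial eigenfunctions of the Laplacian\<close>

definition radial_eigenfunction :: "complex \<Rightarrow> real^'n \<Rightarrow> complex" where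
  "radial_eigenfunction \<beta> x =
     hyp0F1 (real CARD('n) / 2) (- \<beta> * complex_of_real ((norm x)\<^sup>2) / 4)"

lemma norm_squared_axis_shift:
  fixes y :: "real^'n"
  shows "(norm (y + t *\<^sub>R axis i 1))\<^sup>2 = (norm y)\<^sup>2 + 2 * t * y $ i + t\<^sup>2"
  unfolding power2_norm_eq_inner
  by (simp add: inner_add_left inner_add_right inner_axis inner_axis' power2_eq_square algebra_simps)

text \<open>For u = h(s) with s = -\<beta>|x|^2/4 the i-th partial derivative of s is -\<beta>
  x_i/2, so \<Delta>u = \<beta>(s h'' + (n/2) h'). The constant 1/4 and the index n/2 are those for
  which \<open>hyp0F1_ode\<close> turns this into \<beta>u.\<close>

lemma has_Delta_radial_eigenfunction:
  fixes x :: "real^'n"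
  assumes n: "CARD('n) > 1"
  shows "has_Delta (radial_eigenfunction \<beta>) x (\<beta> * radial_eigenfunction \<beta> x)"
proof -
  let ?c = "real CARD('n) / 2"
  have c: "?c \<ge> 1" using n by simp
  define s where "s y = - \<beta> * complex_of_real ((norm y)\<^sup>2) / 4" for y :: "real^'n"
  have s_deriv: "((\<lambda>t. s (y + t *\<^sub>R axis i 1)) has_vector_derivative - \<beta> * complex_of_real (y $ i) / 2) (at 0)"
    for y i
  proof -
    have "((\<lambda>t. - \<beta> / 4 * complex_of_real ((norm y)\<^sup>2 + 2 * t * y $ i + t\<^sup>2))
       has_vector_derivative - \<beta> / 4 * complex_of_real (2 * y $ i)) (at 0)"
      by (rule has_vector_derivative_mult_right, rule has_vector_derivative_of_real)
         (auto intro!: derivative_eq_intros)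
    moreover have "s (y + t *\<^sub>R axis i 1) =
        - \<beta> / 4 * complex_of_real ((norm y)\<^sup>2 + 2 * t * y $ i + t\<^sup>2)" for t
      by (simp add: s_def norm_squared_axis_shift)
    ultimately show ?thesis by simp
  qed
  have F1: "((\<lambda>t. hyp0F1 ?c (s (y + t *\<^sub>R axis i 1))) has_vector_derivative
      - \<beta> * complex_of_real (y $ i) / 2 * hyp0F1' ?c (s y)) (at 0)" for y i
    using field_vector_diff_chain_at[OF s_deriv[of y i], of "hyp0F1 ?c" "hyp0F1' ?c (s y)"]
      has_field_derivative_hyp0F1[OF c] by (simp add: o_def)
  have F2: "((\<lambda>t. hyp0F1' ?c (s (y + t *\<^sub>R axis i 1))) has_vector_derivative
      - \<beta> * complex_of_real (y $ i) / 2 * hyp0F1'' ?c (s y)) (at 0)" for y i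
    using field_vector_diff_chain_at[OF s_deriv[of y i], of "hyp0F1' ?c" "hyp0F1'' ?c (s y)"]
      has_field_derivative_hyp0F1'[OF c] by (simp add: o_def)
  define D where "D i y = - \<beta> / 2 * (complex_of_real (y $ i) * hyp0F1' ?c (s y))" for i and y :: "real^'n"
  define H where "H i = - \<beta> / 2 * (hyp0F1' ?c (s x) + complex_of_real (x $ i) *
      (- \<beta> * complex_of_real (x $ i) / 2 * hyp0F1'' ?c (s x)))" for i
  have "((\<lambda>t. radial_eigenfunction \<beta> (y + t *\<^sub>R axis i 1)) has_vector_derivative D i y) (at 0)" for i y
    using F1[of y i] by (simp add: radial_eigenfunction_def s_def D_def mult_ac)
  moreover have "((\<lambda>t. D i (x + t *\<^sub>R axis i 1)) has_vector_derivative H i) (at 0)" for i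
  proof -
    have "((\<lambda>t. complex_of_real (x $ i + t)) has_vector_derivative complex_of_real 1) (at 0)"
      by (rule has_vector_derivative_of_real)
         (auto intro!: derivative_eq_intros)
    from has_vector_derivative_mult_right[OF has_vector_derivative_mult[OF this F2[of x i]], of "- \<beta> / 2"]
    show ?thesis by (simp add: D_def H_def axis_def add.commute)
  qed
  moreover have "\<beta> * radial_eigenfunction \<beta> x = - (\<Sum>i\<in>UNIV. H i)"
  proof -
    have "(\<Sum>i\<in>UNIV. complex_of_real (x $ i) ^ 2) = complex_of_real ((norm x)\<^sup>2)"
    proof -
      have "(norm x)\<^sup>2 = (\<Sum>i\<in>UNIV. (x $ i)\<^sup>2)"
        unfolding power2_norm_eq_inner by (simp add: inner_vec_def power2_eq_square)
      then show ?thesis by simp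
    qed
    moreover have "(\<Sum>i\<in>UNIV. H i) = - \<beta> / 2 * (of_nat CARD('n) * hyp0F1' ?c (s x)) +
        \<beta>\<^sup>2 / 4 * hyp0F1'' ?c (s x) * (\<Sum>i\<in>UNIV. complex_of_real (x $ i) ^ 2)"
      unfolding sum_distrib_left H_def
      by (simp add: sum.distrib sum_distrib_left power2_eq_square algebra_simps sum_negf sum_subtractf)
    ultimately have "- (\<Sum>i\<in>UNIV. H i) = \<beta> * (s x * hyp0F1'' ?c (s x) + complex_of_real ?c * hyp0F1' ?c (s x))"
      by (simp add: s_def power2_eq_square algebra_simps)
    then show ?thesis
      by (simp only: hyp0F1_ode[OF c]) (simp add: radial_eigenfunction_def s_def)
  qed
  ultimately show ?thesis
    unfolding has_Delta_def by blast
qed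

section \<open>Uniqueness of radial eigenfunctions\<close>

text \<open>Derivatives at a point are unique, so the existentially quantified \<open>D\<close> is
  determined by \<open>f\<close>, and then so is \<open>H\<close>.\<close>

lemma has_Delta_unique:
  assumes "has_Delta f x L" "has_Delta f x M"
  shows "L = M"
proof -
  obtain D H where D: "\<And>i y. ((\<lambda>t. f (y + t *\<^sub>R axis i 1)) has_vector_derivative D i y) (at 0)"
    and H: "\<And>i. ((\<lambda>t. D i (x + t *\<^sub>R axis i 1)) has_vector_derivative H i) (at 0)"
    and L: "L = - (\<Sum>i\<in>UNIV. H i)"
    using assms(1) unfolding has_Delta_def by blast
  obtain D' H' where D': "\<And>i y. ((\<lambda>t. f (y + t *\<^sub>R axis i 1)) has_vector_derivative D' i y) (at 0)"
    and H': "\<And>i. ((\<lambda>t. D' i (x + t *\<^sub>R axis i 1)) has_vector_derivative H' i) (at 0)"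
    and M: "M = - (\<Sum>i\<in>UNIV. H' i)"
    using assms(2) unfolding has_Delta_def by blast
  have "D' = D" by (intro ext) (rule vector_derivative_unique_at[OF D' D])
  then have "H' i = H i" for i
    using H' by (intro vector_derivative_unique_at[OF _ H]) simp
  then show ?thesis using L M by simp
qed

lemma has_Delta_diff:
  assumes "has_Delta f x L" "has_Delta g x M"
  shows "has_Delta (\<lambda>x. f x - g x) x (L - M)"
proof -
  obtain D H where D: "\<And>i y. ((\<lambda>t. f (y + t *\<^sub>R axis i 1)) has_vector_derivative D i y) (at 0)"
    and H: "\<And>i. ((\<lambda>t. D i (x + t *\<^sub>R axis i 1)) has_vector_derivative H i) (at 0)"
    and L: "L = - (\<Sum>i\<in>UNIV. H i)"
    using assms(1) unfolding has_Delta_def by blast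
  obtain D' H' where D': "\<And>i y. ((\<lambda>t. g (y + t *\<^sub>R axis i 1)) has_vector_derivative D' i y) (at 0)"
    and H': "\<And>i. ((\<lambda>t. D' i (x + t *\<^sub>R axis i 1)) has_vector_derivative H' i) (at 0)"
    and M: "M = - (\<Sum>i\<in>UNIV. H' i)"
    using assms(2) unfolding has_Delta_def by blast
  show ?thesis unfolding has_Delta_def
    by (rule exI[of _ "\<lambda>i y. D i y - D' i y"], rule exI[of _ "\<lambda>i. H i - H' i"])
       (auto intro!: has_vector_derivative_diff D D' H H' simp: L M sum_subtractf)
qed

text \<open>Turns the derivatives at 0 of shifted functions, in which \<open>has_Delta\<close> is
  phrased, into derivatives at the points of a line.\<close>

lemma has_vector_derivative_translate:
  fixes f :: "real \<Rightarrow> 'a::real_normed_vector"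
  assumes "((\<lambda>s. f (t + s)) has_vector_derivative d) (at 0)"
  shows "(f has_vector_derivative d) (at t)"
proof -
  have "((\<lambda>s. s - t) has_vector_derivative 1) (at t)"
    by (auto intro!: derivative_eq_intros)
  from vector_diff_chain_at[OF this, of "\<lambda>s. f (t + s)" d] assms show ?thesis
    by (simp add: o_def)
qed

text \<open>The product rule would ask for differentiability of \<open>q\<close>; as the other
  factor vanishes at 0, continuity suffices. This yields the second derivative across a ray.\<close>

lemma has_vector_derivative_scaleR_at_0:
  fixes q :: "real \<Rightarrow> 'a::real_normed_vector"
  assumes "isCont q 0"
  shows "((\<lambda>s. s *\<^sub>R q s) has_vector_derivative q 0) (at 0)"
  unfolding has_vector_derivative_def has_derivative_at
proof safe
  have "((\<lambda>h. norm (q h - q 0)) \<longlongrightarrow> 0) (at 0)"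
    using assms unfolding isCont_def by (rule tendsto_norm_zero[OF LIM_zero])
  then show "((\<lambda>h. norm ((0 + h) *\<^sub>R q (0 + h) - 0 *\<^sub>R q 0 - h *\<^sub>R q 0) / norm h) \<longlongrightarrow> 0) (at 0)"
    by (rule Lim_transform_eventually)
       (auto simp: eventually_at_filter simp flip: scaleR_diff_right)
qed (rule bounded_linear_scaleR_left)

text \<open>Along a ray the equation becomes \<open>g'' + (n - 1)/t g' + \<beta> g = 0\<close>. The singular term only damps
  the energy \<open>|g|\<^sup>2 + |g'|\<^sup>2\<close>, which therefore grows at most exponentially, from the value 0.\<close>

lemma radial_Helmholtz_eq_0:
  fixes u :: "real^'n \<Rightarrow> complex"
  assumes radial: "\<And>x y. norm x = norm y \<Longrightarrow> u x = u y"
    and Delta: "\<And>x. has_Delta u x (\<beta> * u x)"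
    and u0: "u 0 = 0"
  shows "u x = 0"
proof -
  \<comment> \<open>\<open>has_Delta\<close> supplies its first derivatives separately at each
    point. Being unique, they agree with one global \<open>D\<close>, after which \<open>H\<close>
    can be chosen for all points together.\<close>
  define D where "D i y = vector_derivative (\<lambda>t. u (y + t *\<^sub>R axis i 1)) (at 0)" for i y
  have D: "((\<lambda>t. u (y + t *\<^sub>R axis i 1)) has_vector_derivative D i y) (at 0)" for i y
    using Delta[of y] unfolding has_Delta_def D_def by (metis vector_derivative_at)
  have exH: "\<exists>H. (\<forall>i. ((\<lambda>t. D i (y + t *\<^sub>R axis i 1)) has_vector_derivative H i) (at 0)) \<and>
      \<beta> * u y = - (\<Sum>i\<in>UNIV. H i)" for y
  proof -
    obtain D' H' where D': "\<And>i y. ((\<lambda>t. u (y + t *\<^sub>R axis i 1)) has_vector_derivative D' i y) (at 0)"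
      and H': "\<And>i. ((\<lambda>t. D' i (y + t *\<^sub>R axis i 1)) has_vector_derivative H' i) (at 0)"
      and M: "\<beta> * u y = - (\<Sum>i\<in>UNIV. H' i)"
      using Delta[of y] unfolding has_Delta_def by blast
    have "D' = D" by (intro ext) (rule vector_derivative_unique_at[OF D' D])
    then show ?thesis using H' M by blast
  qed
  then obtain H where H: "\<And>y i. ((\<lambda>t. D i (y + t *\<^sub>R axis i 1)) has_vector_derivative H y i) (at 0)"
    and bu: "\<And>y. \<beta> * u y = - (\<Sum>i\<in>UNIV. H y i)"
    by metis
  fix a :: 'n
  \<comment> \<open>A coordinate axis serves as the ray, so the derivatives along it are partial
    derivatives already at hand.\<close>
  define e :: "real^'n" where "e = axis a 1"
  have norme: "norm e = 1" by (simp add: e_def)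
  define g where "g t = u (t *\<^sub>R e)" for t
  define g' where "g' t = D a (t *\<^sub>R e)" for t
  define g'' where "g'' t = H (t *\<^sub>R e) a" for t
  have g: "(g has_vector_derivative g' t) (at t)" for t
    by (rule has_vector_derivative_translate)
       (use D[of "t *\<^sub>R e" a] in \<open>simp add: g_def g'_def e_def scaleR_add_left\<close>)
  have g1: "(g' has_vector_derivative g'' t) (at t)" for t
    by (rule has_vector_derivative_translate)
       (use H[where y = "t *\<^sub>R e" and i = a] in \<open>simp add: g''_def g'_def e_def scaleR_add_left\<close>)
  have g_norm: "u y = g (norm y)" for y
    unfolding g_def by (rule radial) (simp add: norme)
  have g0: "g 0 = 0" using u0 by (simp add: g_def)
  have g'0: "g' 0 = 0"
  proof -
    have "g (- t) = g t" for t unfolding g_def by (rule radial) simp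
    then have "(g has_vector_derivative - g' 0) (at 0)"
      using vector_diff_chain_at[OF has_vector_derivative_minus[OF has_vector_derivative_id], where g = g and g' = "g' 0" and x = 0]
        g[of 0] by (simp add: o_def)
    from vector_derivative_unique_at[OF this g] show ?thesis by simp
  qed
  \<comment> \<open>Stepping sideways by s from r e leads to norm \<rho> = sqrt(r^2 + s^2), so the
    partial derivative there is s g'(\<rho>)/\<rho>. Its derivative at s = 0 is g'(r)/r, and the n -
    1 sideways directions together make up the singular term.\<close>
  have Hj: "H (r *\<^sub>R e) j = g' r /\<^sub>R r" if r: "r > 0" and j: "j \<noteq> a" for r j
  proof -
    let ?\<rho> = "\<lambda>s. sqrt (r\<^sup>2 + s\<^sup>2)"
    have nrm: "norm (r *\<^sub>R e + s *\<^sub>R axis j 1) = ?\<rho> s" for s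
    proof -
      have "e \<bullet> axis j 1 = 0" using j by (simp add: e_def inner_axis_axis)
      then have "(norm (r *\<^sub>R e + s *\<^sub>R axis j 1))\<^sup>2 = r\<^sup>2 + s\<^sup>2"
        unfolding power2_norm_eq_inner
        by (simp add: inner_add_left inner_add_right inner_commute e_def inner_axis_axis power2_eq_square)
      then show ?thesis by (simp add: real_sqrt_unique)
    qed
    have pos: "r\<^sup>2 + s\<^sup>2 > 0" for s using r by (simp add: add_pos_nonneg)
    have "((\<lambda>t. u (r *\<^sub>R e + t *\<^sub>R axis j 1)) has_vector_derivative (s / ?\<rho> s) *\<^sub>R g' (?\<rho> s)) (at s)" for s
    proof -
      have "(?\<rho> has_vector_derivative s / ?\<rho> s) (at s)"
        unfolding has_real_derivative_iff_has_vector_derivative[symmetric]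
        using pos[of s] by (auto intro!: derivative_eq_intros simp: field_simps)
      from vector_diff_chain_at[OF this g] show ?thesis
        by (simp add: o_def g_norm nrm)
    qed
    moreover have "((\<lambda>t. u (r *\<^sub>R e + t *\<^sub>R axis j 1)) has_vector_derivative D j (r *\<^sub>R e + s *\<^sub>R axis j 1)) (at s)" for s
      by (rule has_vector_derivative_translate)
         (use D[of "r *\<^sub>R e + s *\<^sub>R axis j 1" j] in \<open>simp add: scaleR_add_left add.assoc\<close>)
    ultimately have Dj: "D j (r *\<^sub>R e + s *\<^sub>R axis j 1) = s *\<^sub>R (g' (?\<rho> s) /\<^sub>R ?\<rho> s)" for s
      using vector_derivative_unique_at[where x = s] by (simp add: divide_inverse) blast
    have "isCont (\<lambda>s. g' (?\<rho> s) /\<^sub>R ?\<rho> s) 0"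
    proof -
      have "isCont (\<lambda>s. g' (?\<rho> s)) 0"
        by (rule isCont_o2[where g = g']) (auto intro!: continuous_intros has_vector_derivative_continuous[OF g1])
      moreover have "isCont (\<lambda>s. inverse (?\<rho> s)) 0"
        using r by (auto intro!: continuous_intros)
      ultimately show ?thesis by (intro continuous_scaleR)
    qed
    from has_vector_derivative_scaleR_at_0[OF this]
    have "((\<lambda>s. D j (r *\<^sub>R e + s *\<^sub>R axis j 1)) has_vector_derivative g' r /\<^sub>R r) (at 0)"
      using r by (simp add: Dj)
    from vector_derivative_unique_at[OF H this] show ?thesis .
  qed
  have ode: "g'' r = - \<beta> * g r - ((real CARD('n) - 1) / r) *\<^sub>R g' r" if r: "r > 0" for r
  proof -
    have "- (\<beta> * g r) = (\<Sum>i\<in>UNIV. H (r *\<^sub>R e) i)" using bu[of "r *\<^sub>R e"] by (simp add: g_def)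
    also have "\<dots> = g'' r + (\<Sum>i\<in>UNIV - {a}. H (r *\<^sub>R e) i)"
      by (simp add: sum.remove[of UNIV a] g''_def)
    also have "(\<Sum>i\<in>UNIV - {a}. H (r *\<^sub>R e) i) = (\<Sum>i\<in>UNIV - {a}. g' r /\<^sub>R r)"
      using r by (intro sum.cong) (auto simp: Hj)
    also have "\<dots> = ((real CARD('n) - 1) / r) *\<^sub>R g' r"
      by (simp add: card_Diff_singleton of_nat_diff scaleR_conv_of_real divide_inverse
          Suc_leI zero_less_card_finite)
    finally show ?thesis by (simp add: algebra_simps)
  qed
  define E where "E t = g t \<bullet> g t + g' t \<bullet> g' t" for t
  \<comment> \<open>The derivative of the energy is at most 2(1 + |\<beta>|)|g||g'|, and 2|g||g'| is
    at most |g|^2 + |g'|^2.\<close>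
  define C where "C = 1 + norm \<beta>"
  define d where "d t = 2 * (g t \<bullet> g' t) + 2 * (g' t \<bullet> g'' t)" for t
  have dE: "(E has_real_derivative d t) (at t)" for t
    unfolding E_def has_real_derivative_iff_has_vector_derivative
    using has_vector_derivative_add[OF
        bounded_bilinear.has_vector_derivative[OF bounded_bilinear_inner g g]
        bounded_bilinear.has_vector_derivative[OF bounded_bilinear_inner g1 g1], of t]
    by (simp add: d_def inner_commute)
  \<comment> \<open>At t = 0 the differential equation gives nothing about \<open>g''\<close>, but
    \<open>d\<close> vanishes there because \<open>g\<close> and \<open>g'\<close> do.\<close>
  have dC: "d t \<le> C * E t" if t: "t \<ge> 0" for t
  proof (cases "t = 0")
    case True
    then show ?thesis by (simp add: d_def E_def g0 g'0)
  next
    case False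
    then have t: "t > 0" using t by simp
    have "1 \<le> CARD('n)" using zero_less_card_finite[where 'a = 'n] by linarith
    then have "(real CARD('n) - 1) / t * (g' t \<bullet> g' t) \<ge> 0" using t by simp
    then have "g' t \<bullet> g'' t \<le> - (g' t \<bullet> (\<beta> * g t))"
      by (simp add: ode[OF t] inner_diff_right)
    also have "\<dots> \<le> norm (g' t) * (norm \<beta> * norm (g t))"
      using norm_cauchy_schwarz[of "- g' t" "\<beta> * g t"] by (simp add: norm_mult)
    finally have 1: "g' t \<bullet> g'' t \<le> norm \<beta> * (norm (g t) * norm (g' t))" by (simp add: mult_ac)
    have 2: "g t \<bullet> g' t \<le> norm (g t) * norm (g' t)" by (rule norm_cauchy_schwarz)
    have "d t \<le> C * (2 * norm (g t) * norm (g' t))"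
      using 1 2 by (simp add: d_def C_def algebra_simps)
    also have "\<dots> \<le> C * E t"
    proof (rule mult_left_mono)
      show "2 * norm (g t) * norm (g' t) \<le> E t"
        unfolding E_def using sum_squares_bound[of "norm (g t)" "norm (g' t)"]
        by (simp flip: power2_norm_eq_inner)
    qed (simp add: C_def)
    finally show ?thesis .
  qed
  have "E t = 0" if t: "t \<ge> 0" for t
  proof -
    have "E t * exp (- C * t) \<le> E 0 * exp (- C * 0)"
    proof (rule DERIV_nonpos_imp_nonincreasing[OF t])
      fix s assume s: "0 \<le> s" "s \<le> t"
      have "((\<lambda>s. E s * exp (- C * s)) has_real_derivative (d s - C * E s) * exp (- C * s)) (at s)"
        by (auto intro!: derivative_eq_intros dE simp: algebra_simps)
      moreover have "(d s - C * E s) * exp (- C * s) \<le> 0"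
        using dC[OF s(1)] by (simp add: mult_nonpos_nonneg)
      ultimately show "\<exists>y. ((\<lambda>s. E s * exp (- C * s)) has_real_derivative y) (at s) \<and> y \<le> 0" by blast
    qed
    also have "E 0 * exp (- C * 0) = 0" by (simp add: E_def g0 g'0)
    finally have "E t \<le> 0" by (simp add: mult_le_0_iff)
    moreover have "E t \<ge> 0" by (simp add: E_def)
    ultimately show ?thesis by simp
  qed
  then have "g (norm x) = 0"
    unfolding E_def by (metis add_nonneg_eq_0_iff inner_eq_zero_iff inner_ge_zero norm_ge_zero)
  then show ?thesis by (simp add: g_norm)
qed

section \<open>Bessel functions and the Poisson integral\<close>

text \<open>Since \<Gamma>(\<nu>+k+1) = (\<nu>+1)_k \<Gamma>(\<nu>+1), the series in
  \<open>bessel_J\<close> is that of \<open>hyp0F1\<close> up to a constant; what remains is to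
  cancel the two complex powers.\<close>

lemma bessel_J_quot_nonzero:
  assumes "\<nu> \<ge> 0" "t \<noteq> 0"
  shows "t powr complex_of_real (- \<nu>) * bessel_J \<nu> t =
    complex_of_real (2 powr (- \<nu>) / Gamma (\<nu> + 1)) * hyp0F1 (\<nu> + 1) (- t\<^sup>2 / 4)"
proof -
  have G: "Gamma (\<nu> + 1) > 0" using assms(1) by (intro Gamma_real_pos) simp
  have "complex_of_real ((-1) ^ k / (fact k * Gamma (\<nu> + real k + 1))) * (t / 2) ^ (2 * k) =
      complex_of_real (1 / Gamma (\<nu> + 1)) * (hyp0F1_coeff (\<nu> + 1) k * (- t\<^sup>2 / 4) ^ k)" for k
  proof -
    have "\<nu> + 1 \<notin> \<int>\<^sub>\<le>\<^sub>0"
      using assms(1) by (auto elim!: nonpos_Ints_cases)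
    then have "Gamma (\<nu> + real k + 1) = pochhammer (\<nu> + 1) k * Gamma (\<nu> + 1)"
      using pochhammer_Gamma[of "\<nu> + 1" k] G by (simp add: add_ac)
    moreover have "(- t\<^sup>2 / 4) ^ k = (-1) ^ k * (t / 2) ^ (2 * k)"
    proof -
      have "- t\<^sup>2 / 4 = (-1) * (t / 2)\<^sup>2" by (simp add: power_divide)
      then show ?thesis by (simp only: power_mult_distrib power_mult)
    qed
    ultimately show ?thesis by (simp add: hyp0F1_coeff_def)
  qed
  then have "(\<Sum>k. complex_of_real ((-1) ^ k / (fact k * Gamma (\<nu> + real k + 1))) * (t / 2) ^ (2 * k)) =
      complex_of_real (1 / Gamma (\<nu> + 1)) * hyp0F1 (\<nu> + 1) (- t\<^sup>2 / 4)"
    unfolding hyp0F1_def using assms(1)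
    by (simp only:) (intro suminf_mult summable_hyp0F1_coeff, simp)
  moreover have "t powr complex_of_real (- \<nu>) * (t / 2) powr complex_of_real \<nu> = complex_of_real (2 powr (- \<nu>))"
  proof -
    \<comment> \<open>Division by a positive real does not change the argument, so the principal
      branches of the two powers fit together.\<close>
    have "Ln (t / 2) = Ln (complex_of_real (1 / 2) * t)" by simp
    also have "\<dots> = Ln (complex_of_real (1 / 2)) + Ln t"
      by (rule Ln_times_of_real) (use assms(2) in simp_all)
    also have "Ln (complex_of_real (1 / 2)) = complex_of_real (ln (1 / 2))"
      by (rule Ln_of_real) simp
    also have "ln (1 / 2 :: real) = - ln 2" by (simp add: ln_div)
    finally have L: "Ln (t / 2) = Ln t - complex_of_real (ln 2)" by simp
    have "t powr complex_of_real (- \<nu>) * (t / 2) powr complex_of_real \<nu> =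
        exp (complex_of_real (- \<nu>) * Ln t) * exp (complex_of_real \<nu> * Ln (t / 2))"
      using assms(2) by (simp add: powr_def)
    also have "\<dots> = exp (complex_of_real (- \<nu>) * Ln t + complex_of_real \<nu> * (Ln t - complex_of_real (ln 2)))"
      by (simp only: exp_add L)
    also have "\<dots> = exp (complex_of_real (- \<nu> * ln 2))"
      by (simp add: algebra_simps)
    also have "\<dots> = complex_of_real (2 powr (- \<nu>))"
      by (subst exp_of_real) (simp add: powr_def)
    finally show ?thesis .
  qed
  ultimately show ?thesis
    unfolding bessel_J_def using assms(2) by (simp add: mult.assoc[symmetric])
qed

text \<open>The right side is continuous at 0, so its value there is the limit by which
  \<open>bessel_J_quot\<close> is defined. It sees \<open>t\<close> only through its square, which
  is why either square root of b(\<xi>, \<xi>) will do.\<close>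

lemma bessel_J_quot_eq:
  assumes "\<nu> \<ge> 0"
  shows "bessel_J_quot \<nu> t =
    complex_of_real (2 powr (- \<nu>) / Gamma (\<nu> + 1)) * hyp0F1 (\<nu> + 1) (- t\<^sup>2 / 4)"
proof (cases "t = 0")
  case True
  let ?h = "\<lambda>t. complex_of_real (2 powr (- \<nu>) / Gamma (\<nu> + 1)) * hyp0F1 (\<nu> + 1) (- t\<^sup>2 / 4)"
  have "continuous_on UNIV ?h"
    using assms by (intro continuous_intros continuous_on_compose2[OF continuous_on_hyp0F1[of _ UNIV]]) auto
  then have "isCont ?h 0"
    by (rule continuous_on_interior) simp
  then have "(?h \<longlongrightarrow> ?h 0) (at 0)"
    unfolding isCont_def .
  moreover have "\<forall>\<^sub>F s in at 0. ?h s = s powr complex_of_real (- \<nu>) * bessel_J \<nu> s"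
    unfolding eventually_at_filter
    by (intro always_eventually allI impI) (rule bessel_J_quot_nonzero[OF assms, symmetric])
  ultimately have "((\<lambda>s. s powr complex_of_real (- \<nu>) * bessel_J \<nu> s) \<longlongrightarrow> ?h 0) (at 0)"
    by (rule Lim_transform_eventually)
  then have "Lim (at 0) (\<lambda>s. s powr complex_of_real (- \<nu>) * bessel_J \<nu> s) = ?h 0"
    by (rule tendsto_Lim[OF trivial_limit_at])
  then show ?thesis using True by (simp only: bessel_J_quot_def if_True refl)
next
  case False
  then show ?thesis
    by (simp only: bessel_J_quot_def if_False) (rule bessel_J_quot_nonzero[OF assms])
qed

section \<open>Moments of cosine and sine, and the Poisson integral\<close>

definition cos_sin_moment :: "nat \<Rightarrow> nat \<Rightarrow> real" where
  "cos_sin_moment k p = integral {0..pi} (\<lambda>\<theta>. cos \<theta> ^ k * sin \<theta> ^ p)"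

lemma has_integral_cos_sin_moment:
  "((\<lambda>\<theta>. cos \<theta> ^ k * sin \<theta> ^ p) has_integral cos_sin_moment k p) {0..pi}"
  unfolding cos_sin_moment_def
  by (intro integrable_integral integrable_continuous_interval continuous_intros)

lemma pos_notin_nonpos_Ints: "(x::real) > 0 \<Longrightarrow> x \<notin> \<int>\<^sub>\<le>\<^sub>0"
  by (auto elim!: nonpos_Ints_cases)

text \<open>The derivative of cos^(2j+1) sin^(p+1) combines the two integrands, and this function
  vanishes at 0 and \<pi>.\<close>

lemma cos_sin_moment_rec:
  "real (p + 2 + 2 * j) * cos_sin_moment (2 * Suc j) p = real (2 * j + 1) * cos_sin_moment (2 * j) p"
proof -
  let ?F = "\<lambda>\<theta>::real. cos \<theta> ^ Suc (2 * j) * sin \<theta> ^ Suc p"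
  let ?f = "\<lambda>\<theta>::real. real (p + 2 + 2 * j) * (cos \<theta> ^ (2 * Suc j) * sin \<theta> ^ p) -
      real (2 * j + 1) * (cos \<theta> ^ (2 * j) * sin \<theta> ^ p)"
  have "(?f has_integral ?F pi - ?F 0) {0..pi}"
  proof (rule fundamental_theorem_of_calculus)
    fix x :: real
    have "(?F has_real_derivative
        (1 + real (2 * j)) * (- sin x * cos x ^ (2 * j)) * sin x ^ Suc p +
        (1 + real p) * (cos x * sin x ^ p) * cos x ^ Suc (2 * j)) (at x)"
      by (intro DERIV_mult DERIV_power_Suc DERIV_cos DERIV_sin)
    moreover have "(1 + real (2 * j)) * (- sin x * cos x ^ (2 * j)) * sin x ^ Suc p +
        (1 + real p) * (cos x * sin x ^ p) * cos x ^ Suc (2 * j) =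
        cos x ^ (2 * j) * sin x ^ p * ((1 + real p) * (cos x)\<^sup>2 - (1 + real (2 * j)) * (sin x)\<^sup>2)"
      by (simp add: algebra_simps power2_eq_square)
    moreover have "\<dots> = ?f x"
      unfolding sin_squared_eq by (simp add: algebra_simps power2_eq_square)
    ultimately have "(?F has_real_derivative ?f x) (at x)" by simp
    then show "(?F has_vector_derivative ?f x) (at x within {0..pi})"
      by (simp add: has_real_derivative_iff_has_vector_derivative has_vector_derivative_at_within)
  qed simp
  moreover have "(?f has_integral real (p + 2 + 2 * j) * cos_sin_moment (2 * Suc j) p -
      real (2 * j + 1) * cos_sin_moment (2 * j) p) {0..pi}"
    by (intro has_integral_diff has_integral_mult_right has_integral_cos_sin_moment)
  ultimately have "?F pi - ?F 0 = real (p + 2 + 2 * j) * cos_sin_moment (2 * Suc j) p -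
      real (2 * j + 1) * cos_sin_moment (2 * j) p"
    by (rule has_integral_unique)
  then show ?thesis by simp
qed

text \<open>The same argument with the function cos sin^(p+1).\<close>

lemma sin_moment_rec:
  "real (p + 2) * cos_sin_moment 0 (p + 2) = real (p + 1) * cos_sin_moment 0 p"
proof -
  let ?F = "\<lambda>\<theta>::real. cos \<theta> * sin \<theta> ^ Suc p"
  let ?f = "\<lambda>\<theta>::real. real (p + 1) * (cos \<theta> ^ 0 * sin \<theta> ^ p) - real (p + 2) * (cos \<theta> ^ 0 * sin \<theta> ^ (p + 2))"
  have "(?f has_integral ?F pi - ?F 0) {0..pi}"
  proof (rule fundamental_theorem_of_calculus)
    fix x :: real
    have "(?F has_real_derivative
        (- sin x) * sin x ^ Suc p + (1 + real p) * (cos x * sin x ^ p) * cos x) (at x)"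
      by (intro DERIV_mult DERIV_power_Suc DERIV_cos DERIV_sin)
    moreover have "(- sin x) * sin x ^ Suc p + (1 + real p) * (cos x * sin x ^ p) * cos x =
        sin x ^ p * ((1 + real p) * (cos x)\<^sup>2 - (sin x)\<^sup>2)"
      by (simp add: algebra_simps power2_eq_square)
    moreover have "\<dots> = ?f x"
      unfolding cos_squared_eq by (simp add: algebra_simps power2_eq_square)
    ultimately have "(?F has_real_derivative ?f x) (at x)" by simp
    then show "(?F has_vector_derivative ?f x) (at x within {0..pi})"
      by (simp add: has_real_derivative_iff_has_vector_derivative has_vector_derivative_at_within)
  qed simp
  moreover have "(?f has_integral real (p + 1) * cos_sin_moment 0 p - real (p + 2) * cos_sin_moment 0 (p + 2)) {0..pi}"
    by (intro has_integral_diff has_integral_mult_right has_integral_cos_sin_moment)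
  ultimately have "?F pi - ?F 0 = real (p + 1) * cos_sin_moment 0 p - real (p + 2) * cos_sin_moment 0 (p + 2)"
    by (rule has_integral_unique)
  then show ?thesis by simp
qed

text \<open>The recursion relates p + 2 to p, hence the two starting values, \<pi> at p = 0 and 2 at
  p = 1; the functional equation of \<Gamma> matches the step.\<close>

lemma sin_moment_eq:
  "cos_sin_moment 0 p = sqrt pi * Gamma ((real p + 1) / 2) / Gamma (real p / 2 + 1)"
proof (induction p rule: induct_nat_012)
  case 0
  show ?case by (simp add: cos_sin_moment_def Gamma_one_half_real)
next
  case 1
  have "((\<lambda>\<theta>. sin \<theta>) has_integral (- cos pi) - (- cos 0)) {0..pi}"
    by (rule fundamental_theorem_of_calculus)
       (auto intro!: derivative_eq_intros simp flip: has_real_derivative_iff_has_vector_derivative)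
  then have "cos_sin_moment 0 1 = 2" by (simp add: cos_sin_moment_def integral_unique)
  moreover have G: "Gamma (3 / 2 :: real) = sqrt pi / 2"
    using Gamma_plus1[OF pos_notin_nonpos_Ints, of "1 / 2"] by (simp add: Gamma_one_half_real)
  ultimately show ?case unfolding One_nat_def[symmetric] by (simp add: G)
next
  case (ge2 p)
  have 1: "Gamma ((real p + 1) / 2 + 1) = (real p + 1) / 2 * Gamma ((real p + 1) / 2)"
    by (intro Gamma_plus1 pos_notin_nonpos_Ints) simp
  have 2: "Gamma ((real p / 2 + 1) + 1) = (real p / 2 + 1) * Gamma (real p / 2 + 1)"
    by (intro Gamma_plus1 pos_notin_nonpos_Ints) simp
  have G: "Gamma (real p / 2 + 1) > 0" by (intro Gamma_real_pos) simp
  have "cos_sin_moment 0 (Suc (Suc p)) = (real p + 1) / (real p + 2) * cos_sin_moment 0 p"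
    using sin_moment_rec[of p] by (simp add: field_simps)
  also have "\<dots> = sqrt pi * ((real p + 1) / 2 * Gamma ((real p + 1) / 2)) /
      ((real p / 2 + 1) * Gamma (real p / 2 + 1))"
    unfolding ge2 using G by (simp add: divide_simps)
  also have "\<dots> = sqrt pi * Gamma ((real (Suc (Suc p)) + 1) / 2) / Gamma (real (Suc (Suc p)) / 2 + 1)"
    unfolding 1[symmetric] 2[symmetric] by (simp add: add_divide_distrib add_ac)
  finally show ?case .
qed

text \<open>Each step contributes the denominator (p+2+2j)(2j+2) = 4(j+1)(c+j); this is where the
  Pochhammer symbol and the powers of 4 come from.\<close>

lemma cos_sin_moment_even:
  assumes "c = real (p + 2) / 2"
  shows "cos_sin_moment (2 * j) p / fact (2 * j) = cos_sin_moment 0 p / (4 ^ j * fact j * pochhammer c j)"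
proof (induction j)
  case (Suc j)
  have "cos_sin_moment (2 * Suc j) p = real (2 * j + 1) * cos_sin_moment (2 * j) p / real (p + 2 + 2 * j)"
    using cos_sin_moment_rec[of p j] by (simp add: nonzero_eq_divide_eq mult.commute)
  moreover have "fact (2 * Suc j) = real (2 * j + 1) * real (2 * j + 2) * fact (2 * j)"
    by (simp add: algebra_simps)
  moreover have "A * M / Q / (A * B * F) = M / F / (Q * B)" if "A \<noteq> 0" for A B M Q F :: real
    using that by simp
  ultimately have "cos_sin_moment (2 * Suc j) p / fact (2 * Suc j) =
      (cos_sin_moment (2 * j) p / fact (2 * j)) / (real (p + 2 + 2 * j) * real (2 * j + 2))"
    by (simp only:)
  also have "real (p + 2 + 2 * j) * real (2 * j + 2) = 4 * real (Suc j) * (c + real j)"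
    by (simp add: assms field_simps)
  finally show ?case
    unfolding Suc by (simp add: pochhammer_Suc mult_ac)
qed simp

text \<open>As |cos \<theta>| and |sin \<theta>| are at most 1, the cosine series is dominated by
  its absolute values at \<open>w\<close>; it converges uniformly and is integrated term by term.
  Only even powers occur, and their moments are known.\<close>

lemma Poisson_integral:
  fixes w :: complex
  assumes "c = real (p + 2) / 2"
  shows "integral {0..pi} (\<lambda>\<theta>. cos (w * complex_of_real (cos \<theta>)) * complex_of_real (sin \<theta> ^ p)) =
    complex_of_real (cos_sin_moment 0 p) * hyp0F1 c (- w\<^sup>2 / 4)"
proof -
  let ?f = "\<lambda>k \<theta>. (cos_coeff k *\<^sub>R (w * complex_of_real (cos \<theta>)) ^ k) * complex_of_real (sin \<theta> ^ p)"
  let ?g = "\<lambda>\<theta>. cos (w * complex_of_real (cos \<theta>)) * complex_of_real (sin \<theta> ^ p)"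
  have c: "c \<ge> 1" by (simp add: assms)
  have sums: "(\<lambda>k. ?f k \<theta>) sums ?g \<theta>" for \<theta>
    by (intro sums_mult2 cos_converges)
  have "uniform_limit {0..pi} (\<lambda>m \<theta>. \<Sum>k<m. ?f k \<theta>) (\<lambda>\<theta>. \<Sum>k. ?f k \<theta>) sequentially"
  proof (rule Weierstrass_m_test)
    show "summable (\<lambda>k. norm (cos_coeff k *\<^sub>R w ^ k))" by (rule summable_norm_cos)
    fix k \<theta>
    have "norm ((w * complex_of_real (cos \<theta>)) ^ k) \<le> norm (w ^ k) * 1"
      unfolding power_mult_distrib norm_mult
      by (intro mult_left_mono) (simp_all add: norm_power power_le_one)
    moreover have "norm (complex_of_real (sin \<theta> ^ p)) \<le> 1"
      by (simp add: norm_power power_le_one)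
    ultimately have "norm (?f k \<theta>) \<le> (\<bar>cos_coeff k\<bar> * norm (w ^ k)) * 1"
      unfolding norm_mult norm_scaleR by (intro mult_mono) (auto intro: mult_left_mono)
    then show "norm (?f k \<theta>) \<le> norm (cos_coeff k *\<^sub>R w ^ k)" by simp
  qed
  then have unif: "uniform_limit {0..pi} (\<lambda>m \<theta>. \<Sum>k<m. ?f k \<theta>) ?g sequentially"
    using sums_unique[OF sums] by simp
  have f_int: "(?f k has_integral cos_coeff k *\<^sub>R (w ^ k * complex_of_real (cos_sin_moment k p))) {0..pi}" for k
  proof -
    have "((\<lambda>\<theta>. cos_coeff k *\<^sub>R (w ^ k * complex_of_real (cos \<theta> ^ k * sin \<theta> ^ p))) has_integral
        cos_coeff k *\<^sub>R (w ^ k * complex_of_real (cos_sin_moment k p))) {0..pi}"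
      by (intro has_integral_cmul has_integral_mult_right has_integral_of_real has_integral_cos_sin_moment)
    then show ?thesis by (simp add: power_mult_distrib mult_ac)
  qed
  have cont: "continuous_on {0..pi} (\<lambda>\<theta>. \<Sum>k<m. ?f k \<theta>)" for m
    by (intro continuous_intros)
  obtain I J where I: "\<And>m. ((\<lambda>\<theta>. \<Sum>k<m. ?f k \<theta>) has_integral I m) {0..pi}"
    and J: "(?g has_integral J) {0..pi}" and IJ: "I \<longlonglongrightarrow> J"
    using uniform_limit_integral[OF unif cont] by auto
  have "I m = (\<Sum>k<m. cos_coeff k *\<^sub>R (w ^ k * complex_of_real (cos_sin_moment k p)))" for m
    by (rule has_integral_unique[OF I]) (intro has_integral_sum f_int finite_lessThan)
  then have "(\<lambda>k. cos_coeff k *\<^sub>R (w ^ k * complex_of_real (cos_sin_moment k p))) sums J"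
    using IJ unfolding sums_def by presburger
  then have "(\<lambda>j. cos_coeff (2 * j) *\<^sub>R (w ^ (2 * j) * complex_of_real (cos_sin_moment (2 * j) p))) sums J"
  proof (subst sums_mono_reindex[where f = "\<lambda>k. cos_coeff k *\<^sub>R (w ^ k * complex_of_real (cos_sin_moment k p))"])
    show "strict_mono (\<lambda>j::nat. 2 * j)" by (simp add: strict_mono_def)
    fix k :: nat assume "k \<notin> range (\<lambda>j. 2 * j)"
    then have "odd k" by (auto elim: evenE)
    then show "cos_coeff k *\<^sub>R (w ^ k * complex_of_real (cos_sin_moment k p)) = 0"
      by (simp add: cos_coeff_def)
  qed
  moreover have "cos_coeff (2 * j) *\<^sub>R (w ^ (2 * j) * complex_of_real (cos_sin_moment (2 * j) p)) =
      complex_of_real (cos_sin_moment 0 p) * (hyp0F1_coeff c j * (- w\<^sup>2 / 4) ^ j)" for j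
  proof -
    have "cos_coeff (2 * j) *\<^sub>R (w ^ (2 * j) * complex_of_real (cos_sin_moment (2 * j) p)) =
        (-1) ^ j * w ^ (2 * j) * complex_of_real (cos_sin_moment (2 * j) p / fact (2 * j))"
      by (simp add: cos_coeff_def scaleR_conv_of_real)
    also have "\<dots> = complex_of_real (cos_sin_moment 0 p) * (hyp0F1_coeff c j * ((-1) ^ j * w ^ (2 * j) / 4 ^ j))"
      unfolding cos_sin_moment_even[OF assms] by (simp add: hyp0F1_coeff_def mult_ac)
    also have "(-1) ^ j * w ^ (2 * j) / 4 ^ j = (- w\<^sup>2 / 4) ^ j"
      by (simp add: power_divide power_mult power_minus[of "w\<^sup>2 / 4"])
    finally show ?thesis .
  qed
  ultimately have "(\<lambda>j. complex_of_real (cos_sin_moment 0 p) * (hyp0F1_coeff c j * (- w\<^sup>2 / 4) ^ j)) sums J"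
    by simp
  moreover have "(\<lambda>j. complex_of_real (cos_sin_moment 0 p) * (hyp0F1_coeff c j * (- w\<^sup>2 / 4) ^ j)) sums
      (complex_of_real (cos_sin_moment 0 p) * hyp0F1 c (- w\<^sup>2 / 4))"
    unfolding hyp0F1_def by (intro sums_mult summable_sums summable_hyp0F1_coeff c)
  ultimately have "J = complex_of_real (cos_sin_moment 0 p) * hyp0F1 c (- w\<^sup>2 / 4)"
    by (rule sums_unique2)
  then show ?thesis using integral_unique[OF J] by simp
qed

section \<open>Orthogonal invariance of Lebesgue measure\<close>

text \<open>Both measures are translation invariant and agree on the unit ball; Tonelli's theorem turns this into
  equality. The change of variables in the library needs a well-ordered index type.\<close>

lemma distr_lborel_linear_isometry:
  fixes T :: "'a::euclidean_space \<Rightarrow> 'a"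
  assumes T: "orthogonal_transformation T"
  shows "distr lborel borel T = lborel"
proof -
  have lin: "linear T" by (rule orthogonal_transformation_linear[OF T])
  have "bounded_linear T" using lin linear_conv_bounded_linear by blast
  then have [measurable]: "T \<in> borel_measurable borel"
    by (intro borel_measurable_continuous_onI linear_continuous_on)
  obtain S where S: "\<And>x. T (S x) = x"
    using orthogonal_transformation_surj[OF T] by (metis surj_def)
  have [measurable]: "ball (0::'a) 1 \<in> sets borel" by simp
  define g :: "'a \<Rightarrow> ennreal" where "g = indicator (ball 0 1)"
  have [measurable]: "g \<in> borel_measurable borel" unfolding g_def by measurable
  have gT: "g (T y) = g y" for y
    using orthogonal_transformation_norm[OF T] by (simp add: g_def indicator_def)
  have gm: "g (- y) = g y" for y by (simp add: g_def indicator_def)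
  have shift: "(\<integral>\<^sup>+y. h (c + y) \<partial>lborel) = (\<integral>\<^sup>+y. h y \<partial>lborel)"
    if [measurable]: "h \<in> borel_measurable borel" for h :: "'a \<Rightarrow> ennreal" and c
  proof -
    have "(\<integral>\<^sup>+y. h y \<partial>lborel) = (\<integral>\<^sup>+y. h y \<partial>distr lborel borel ((+) c))" by (simp add: lborel_distr_plus)
    also have "\<dots> = (\<integral>\<^sup>+y. h (c + y) \<partial>lborel)" by (subst nn_integral_distr) auto
    finally show ?thesis by simp
  qed
  \<comment> \<open>Both sides equal the double integral of f(x + T y) g(x). Translating y by S x
    gives the left side. Translating x by T y leaves f(x) g(x - T y), and g(x - T y) = g(y - S x)
    because the ball is invariant under T and under negation.\<close>
  have key: "(\<integral>\<^sup>+y. f (T y) \<partial>lborel) * (\<integral>\<^sup>+x. g x \<partial>lborel) = (\<integral>\<^sup>+x. f x \<partial>lborel) * (\<integral>\<^sup>+x. g x \<partial>lborel)"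
    if f[measurable]: "f \<in> borel_measurable borel" for f
  proof -
    have "(\<integral>\<^sup>+y. f (T y) \<partial>lborel) * (\<integral>\<^sup>+x. g x \<partial>lborel)
      = (\<integral>\<^sup>+x. (\<integral>\<^sup>+y. f (T (S x + y)) \<partial>lborel) * g x \<partial>lborel)"
      by (subst nn_integral_cmult[symmetric]) (auto simp: shift[of "\<lambda>y. f (T y)"])
    also have "\<dots> = (\<integral>\<^sup>+x. \<integral>\<^sup>+y. f (x + T y) * g x \<partial>lborel \<partial>lborel)"
      by (intro nn_integral_cong) (simp add: linear_add[OF lin] S nn_integral_multc)
    also have "\<dots> = (\<integral>\<^sup>+y. \<integral>\<^sup>+x. f (x + T y) * g x \<partial>lborel \<partial>lborel)"
      by (rule lborel_pair.Fubini'[symmetric]) measurable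
    also have "\<dots> = (\<integral>\<^sup>+y. \<integral>\<^sup>+x. f x * g (x - T y) \<partial>lborel \<partial>lborel)"
    proof (rule nn_integral_cong)
      fix y
      show "(\<integral>\<^sup>+x. f (x + T y) * g x \<partial>lborel) = (\<integral>\<^sup>+x. f x * g (x - T y) \<partial>lborel)"
        using shift[of "\<lambda>x. f x * g (x - T y)" "T y"] by (simp add: add.commute)
    qed
    also have "\<dots> = (\<integral>\<^sup>+x. \<integral>\<^sup>+y. f x * g (x - T y) \<partial>lborel \<partial>lborel)"
      by (rule lborel_pair.Fubini') measurable
    also have "\<dots> = (\<integral>\<^sup>+x. f x * (\<integral>\<^sup>+y. g y \<partial>lborel) \<partial>lborel)"
    proof (rule nn_integral_cong)
      fix x
      have "g (x - T y) = g (- S x + y)" for y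
      proof -
        have "x - T y = T (- (- S x + y))" by (simp add: linear_diff[OF lin] S)
        then show ?thesis by (metis gT gm)
      qed
      then show "(\<integral>\<^sup>+y. f x * g (x - T y) \<partial>lborel) = f x * (\<integral>\<^sup>+y. g y \<partial>lborel)"
        using shift[of g "- S x"] by (simp add: nn_integral_cmult del: add_uminus_conv_diff uminus_add_conv_diff)
    qed
    finally show ?thesis by (simp add: nn_integral_multc)
  qed
  have gi: "(\<integral>\<^sup>+x. g x \<partial>lborel) = emeasure lborel (ball (0::'a) 1)"
    unfolding g_def by simp
  have gpos: "emeasure lborel (ball (0::'a) 1) \<noteq> 0" "emeasure lborel (ball (0::'a) 1) < \<infinity>"
    using content_ball_pos[of 1 "0::'a"] emeasure_lborel_ball_finite[of "0::'a" 1]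
    by (auto simp: measure_def)
  show ?thesis
  proof (rule measure_eqI)
    fix A assume "A \<in> sets (distr lborel borel T)"
    then have [measurable]: "A \<in> sets borel" by simp
    have "(\<integral>\<^sup>+y. indicator A (T y) \<partial>lborel) = (\<integral>\<^sup>+y. indicator A y \<partial>lborel)"
      using key[of "indicator A"] gpos unfolding gi by (auto simp: mult.commute[of _ "emeasure lborel (ball 0 1)"] ennreal_mult_cancel_left)
    moreover have "(\<integral>\<^sup>+y. indicator A (T y) \<partial>lborel) = (\<integral>\<^sup>+y. indicator A y \<partial>distr lborel borel T)"
      by (subst nn_integral_distr) auto
    ultimately show "emeasure (distr lborel borel T) A = emeasure lborel A"
      by simp
  qed simp
qed

section \<open>Transitive groups and their Haar measure\<close>

lemma motion_group_simps [simp]: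
  "carrier (motion_group K) = UNIV \<times> K"
  "\<one>\<^bsub>motion_group K\<^esub> = (0, mat 1)"
  "(x, k) \<otimes>\<^bsub>motion_group K\<^esub> (y, l) = (x + k *v y, k ** l)"
  by (simp_all add: motion_group_def)

lemma lift_simp [simp]: "lift \<psi> (x, k) = \<psi> x"
  by (simp add: lift_def)

text \<open>The hypotheses are bundled so that the explicit form of \<open>phi\<close> can be
  obtained for two groups side by side, which is how independence of the group is shown.\<close>

locale transitive_pair =
  fixes K :: "(real^'n^'n) set" and \<mu> :: "(real^'n^'n) measure"
  assumes card_gt_1: "CARD('n) > 1"
    and closed_K: "closed K"
    and subgroup_K: "subgroup K orthogonal_group"
    and transitive_K: "transitive_on_spheres K"
    and haar: "haar_probability K \<mu>"
begin

lemma orthogonal_K: "k \<in> K \<Longrightarrow> orthogonal_matrix k"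
  using subgroup.subset[OF subgroup_K] by (auto simp: orthogonal_group_def)

lemma one_K: "mat 1 \<in> K"
  using subgroup.one_closed[OF subgroup_K] by (simp add: orthogonal_group_def)

lemma mult_K: "k \<in> K \<Longrightarrow> l \<in> K \<Longrightarrow> k ** l \<in> K"
  using subgroup.m_closed[OF subgroup_K] by (simp add: orthogonal_group_def)

lemma transpose_mult_K: "k \<in> K \<Longrightarrow> transpose k ** k = mat 1"
  using orthogonal_K[of k] by (simp add: orthogonal_matrix_def)

text \<open>A subgroup is closed under the abstract inverse, so the inverse in
  \<open>orthogonal_group\<close> is first identified with the transpose.\<close>

lemma transpose_K: assumes "k \<in> K" shows "transpose k \<in> K"
proof -
  have grp: "group (orthogonal_group :: (real^'n^'n) monoid)"
  proof (rule groupI)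
    fix A :: "real^'n^'n"
    assume "A \<in> carrier orthogonal_group"
    then show "\<exists>B\<in>carrier orthogonal_group. B \<otimes>\<^bsub>orthogonal_group\<^esub> A = \<one>\<^bsub>orthogonal_group\<^esub>"
      by (intro bexI[of _ "transpose A"]) (auto simp: orthogonal_group_def orthogonal_matrix_def)
  qed (auto simp: orthogonal_group_def orthogonal_matrix_mul orthogonal_matrix_id matrix_mul_assoc)
  have "inv\<^bsub>orthogonal_group\<^esub> k = transpose k"
    using orthogonal_K[OF assms]
    by (intro group.inv_equality[OF grp]) (auto simp: orthogonal_group_def orthogonal_matrix_def)
  then show ?thesis
    using subgroup.m_inv_closed[OF subgroup_K assms] by simp
qed

lemma orthogonal_transformation_K:
  "k \<in> K \<Longrightarrow> orthogonal_transformation (\<lambda>x. k *v x)"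
  using orthogonal_K[of k] by (simp add: orthogonal_transformation_matrix)

lemma norm_K [simp]: "k \<in> K \<Longrightarrow> norm (k *v x) = norm x"
  by (rule orthogonal_transformation_norm[OF orthogonal_transformation_K])

text \<open>The columns of an orthogonal matrix are unit vectors, which bounds every entry by
  1.\<close>

lemma compact_K: "compact K"
proof -
  have "norm k \<le> (\<Sum>i\<in>(UNIV::'n set). \<Sum>j\<in>(UNIV::'n set). 1)" if "k \<in> K" for k
  proof -
    have entry: "\<bar>k $ i $ j\<bar> \<le> 1" for i j
    proof -
      have "k $ i $ j = (k *v axis j 1) $ i" by (simp add: matrix_vector_mult_basis column_def)
      also have "\<bar>\<dots>\<bar> \<le> norm (k *v axis j 1)" by (rule component_le_norm_cart)
      finally show ?thesis using that by simp
    qed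
    have "norm k \<le> (\<Sum>i\<in>UNIV. norm (k $ i))"
      unfolding norm_vec_def[of k] by (rule L2_set_le_sum) simp
    also have "\<dots> \<le> (\<Sum>i\<in>UNIV. \<Sum>j\<in>UNIV. \<bar>k $ i $ j\<bar>)"
      by (intro sum_mono norm_le_l1_cart)
    also have "\<dots> \<le> (\<Sum>i\<in>(UNIV::'n set). \<Sum>j\<in>(UNIV::'n set). 1)"
      by (intro sum_mono entry)
    finally show ?thesis .
  qed
  then have "bounded K" unfolding bounded_iff by blast
  then show ?thesis using closed_K compact_eq_bounded_closed by blast
qed

lemma sets_\<mu>: "sets \<mu> = sets (restrict_space borel K)"
  and emeasure_\<mu>: "emeasure \<mu> K = 1"
  and distr_\<mu>: "k \<in> K \<Longrightarrow> distr \<mu> \<mu> (\<lambda>l. k ** l) = \<mu>"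
  using haar by (auto simp: haar_probability_def)

lemma space_\<mu> [simp]: "space \<mu> = K"
  using sets_eq_imp_space_eq[OF sets_\<mu>] by (simp add: space_restrict_space)

sublocale prob_space \<mu>
  by (rule prob_spaceI) (simp add: emeasure_\<mu>)

lemma measurable_\<mu>_continuous:
  "continuous_on K (h :: _ \<Rightarrow> 'b::topological_space) \<Longrightarrow> h \<in> borel_measurable \<mu>"
  using borel_measurable_continuous_on_restrict[of K h] measurable_cong_sets[OF sets_\<mu> refl]
  by blast

lemma integrable_\<mu>_continuous:
  fixes h :: "_ \<Rightarrow> 'b::{banach,second_countable_topology}"
  assumes "continuous_on K h"
  shows "integrable \<mu> h"
proof -
  have "bounded (h ` K)"
    by (rule compact_imp_bounded[OF compact_continuous_image[OF assms compact_K]])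
  then obtain B where "\<And>k. k \<in> K \<Longrightarrow> norm (h k) \<le> B" unfolding bounded_iff by blast
  then show ?thesis
    by (intro integrable_const_bound[of _ B] measurable_\<mu>_continuous assms) auto
qed

lemma integral_\<mu>_translate:
  fixes h :: "_ \<Rightarrow> 'b::{banach,second_countable_topology}"
  assumes "continuous_on K h" "k \<in> K"
  shows "(\<integral>l. h (k ** l) \<partial>\<mu>) = (\<integral>l. h l \<partial>\<mu>)"
proof -
  have cont: "continuous_on K (\<lambda>l. k ** l)"
    by (intro linear_continuous_on bounded_linearI'[where f = "\<lambda>l. k ** l"])
       (simp_all add: matrix_add_ldistrib matrix_scalar_ac scalar_matrix_assoc)
  have "(\<lambda>l. k ** l) \<in> measurable \<mu> (restrict_space borel K)"
    by (rule measurable_restrict_space2) (use mult_K assms in \<open>auto intro: measurable_\<mu>_continuous cont\<close>)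
  then have m: "(\<lambda>l. k ** l) \<in> measurable \<mu> \<mu>"
    using measurable_cong_sets[OF refl sets_\<mu>] by blast
  have "(\<integral>l. h l \<partial>distr \<mu> \<mu> (\<lambda>l. k ** l)) = (\<integral>l. h (k ** l) \<partial>\<mu>)"
    by (rule integral_distr[OF m measurable_\<mu>_continuous[OF assms(1)]])
  then show ?thesis using distr_\<mu>[OF assms(2)] by simp
qed

section \<open>From functions on the motion group to functions on Euclidean space\<close>

lemma inv_motion_group:
  assumes "k \<in> K"
  shows "inv\<^bsub>motion_group K\<^esub> (x, k) = (- (transpose k *v x), transpose k)"
proof -
  have grp: "group (motion_group K)"
  proof (rule groupI)
    fix g assume "g \<in> carrier (motion_group K)"
    then obtain y l where g: "g = (y, l)" "l \<in> K" by auto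
    then show "\<exists>h\<in>carrier (motion_group K). h \<otimes>\<^bsub>motion_group K\<^esub> g = \<one>\<^bsub>motion_group K\<^esub>"
      by (intro bexI[of _ "(- (transpose l *v y), transpose l)"])
         (auto simp: transpose_K transpose_mult_K)
  qed (auto simp: one_K mult_K matrix_mul_assoc matrix_vector_mul_assoc matrix_vector_right_distrib
      add.assoc)
  show ?thesis
    using assms by (intro group.inv_equality[OF grp]) (auto simp: transpose_K transpose_mult_K)
qed

text \<open>Transitivity enters here: the orbits of \<open>K\<close> are the spheres about 0, and
  from now on invariance under \<open>K\<close> is a condition on the norm that no longer mentions
  the group.\<close>

lemma radial_iff:
  "(\<forall>k\<in>K. \<forall>x. \<psi> (k *v x) = \<psi> x) \<longleftrightarrow> (\<forall>x y. norm x = norm y \<longrightarrow> \<psi> x = \<psi> y)"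
  using transitive_K unfolding transitive_on_spheres_def by (metis norm_K)

text \<open>Multiplying by \<open>K\<close> on the right does not change the translation part of a
  motion, so for a lifted function only left invariance is a condition.\<close>

lemma bi_invariant_lift_iff:
  "bi_invariant K (lift \<psi>) \<longleftrightarrow> (\<forall>x y. norm x = norm y \<longrightarrow> \<psi> x = \<psi> y)"
  unfolding radial_iff[symmetric] bi_invariant_def using one_K by auto

text \<open>The translation part of the product is x - y rotated by the transpose of
  \<open>k\<close>, and a radial function ignores the rotation.\<close>

lemma lift_inv_mult:
  assumes "\<forall>x y. norm x = norm y \<longrightarrow> \<psi> x = \<psi> y" and "k \<in> K"
  shows "lift \<psi> (inv\<^bsub>motion_group K\<^esub> (y, k) \<otimes>\<^bsub>motion_group K\<^esub> (x, l)) = \<psi> (x - y)"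
proof -
  have "lift \<psi> (inv\<^bsub>motion_group K\<^esub> (y, k) \<otimes>\<^bsub>motion_group K\<^esub> (x, l)) =
      \<psi> (transpose k *v (x - y))"
    using assms(2) by (simp add: inv_motion_group matrix_vector_mult_diff_distrib)
  also have "\<dots> = \<psi> (x - y)"
    by (rule assms(1)[rule_format]) (rule norm_K[OF transpose_K[OF assms(2)]])
  finally show ?thesis .
qed

lemma integral_lborel_\<mu>_fst:
  fixes h :: "real^'n \<Rightarrow> complex"
  assumes [measurable]: "h \<in> borel_measurable borel"
  shows "(\<integral>z. h (fst z) \<partial>(lborel \<Otimes>\<^sub>M \<mu>)) = (\<integral>y. h y \<partial>lborel)"
proof -
  have "(\<integral>y. h y \<partial>distr (lborel \<Otimes>\<^sub>M \<mu>) lborel fst) = (\<integral>z. h (fst z) \<partial>(lborel \<Otimes>\<^sub>M \<mu>))"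
    by (rule integral_distr) auto
  then show ?thesis by (simp add: distr_pair_fst)
qed

text \<open>The integrand is independent of the rotation, and the Haar measure has mass 1, so the
  group convolution collapses to the Euclidean one.\<close>

lemma convolution_eq:
  assumes radial: "\<forall>x y. norm x = norm y \<longrightarrow> \<psi> x = \<psi> y"
    and f0: "\<And>y k. k \<in> K \<Longrightarrow> f (y, k) = f0 y"
    and cont: "continuous_on UNIV f0" "continuous_on UNIV \<psi>"
  shows "convolution K \<mu> f (lift \<psi>) (x, l) = (\<integral>y. f0 y * \<psi> (x - y) \<partial>lborel)"
proof -
  have "convolution K \<mu> f (lift \<psi>) (x, l) = (\<integral>h. f0 (fst h) * \<psi> (x - fst h) \<partial>(lborel \<Otimes>\<^sub>M \<mu>))"
    unfolding convolution_def
  proof (rule Bochner_Integration.integral_cong[OF refl])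
    fix h :: "(real^'n) \<times> (real^'n^'n)"
    assume "h \<in> space (lborel \<Otimes>\<^sub>M \<mu>)"
    then obtain y k where "h = (y, k)" "k \<in> K" by (auto simp: space_pair_measure)
    then show "f h * lift \<psi> (inv\<^bsub>motion_group K\<^esub> h \<otimes>\<^bsub>motion_group K\<^esub> (x, l)) =
        f0 (fst h) * \<psi> (x - fst h)"
      using lift_inv_mult[OF radial] f0 by simp
  qed
  also have "\<dots> = (\<integral>y. f0 y * \<psi> (x - y) \<partial>lborel)"
    by (rule integral_lborel_\<mu>_fst[where h = "\<lambda>y. f0 y * \<psi> (x - y)"])
       (intro borel_measurable_continuous_onI continuous_intros
          continuous_on_compose2[OF cont(2)] cont(1), auto)
  finally show ?thesis .
qed

end

section \<open>The functions \<open>\<phi>\<^sub>\<xi>\<close>\<close>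

text \<open>Serves twice: for exponentials integrated over \<open>K\<close>, and for truncated
  powers at their kink.\<close>

lemma has_vector_derivative_quadratic_remainder:
  fixes F :: "real \<Rightarrow> 'a::real_normed_vector"
  assumes "\<And>t. \<bar>t\<bar> \<le> 1 \<Longrightarrow> norm (F t - F 0 - t *\<^sub>R d) \<le> C * t\<^sup>2"
  shows "(F has_vector_derivative d) (at 0)"
  unfolding has_vector_derivative_def has_derivative_at
proof safe
  show "((\<lambda>h. norm (F (0 + h) - F 0 - h *\<^sub>R d) / norm h) \<longlongrightarrow> 0) (at 0)"
  proof (rule Lim_null_comparison)
    show "((\<lambda>h. C * \<bar>h\<bar>) \<longlongrightarrow> 0) (at 0)"
      by (auto intro!: tendsto_eq_intros)
    show "\<forall>\<^sub>F h in at 0. norm (norm (F (0 + h) - F 0 - h *\<^sub>R d) / norm h) \<le> C * \<bar>h\<bar>"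
      unfolding eventually_at
    proof (intro exI[of _ 1] conjI ballI impI)
      fix h :: real assume h: "h \<noteq> 0 \<and> dist h 0 < 1"
      then have "norm (F h - F 0 - h *\<^sub>R d) \<le> C * \<bar>h\<bar> * \<bar>h\<bar>"
        using assms[of h] by (simp add: power2_eq_square)
      then show "norm (norm (F (0 + h) - F 0 - h *\<^sub>R d) / norm h) \<le> C * \<bar>h\<bar>"
        using h by (simp add: divide_le_eq)
    qed simp
  qed
qed (rule bounded_linear_scaleR_left)

section \<open>The bilinear form under shifts and complexified rotations\<close>

lemma bform_cvec_axis_shift:
  "bform (cvec (x + t *\<^sub>R axis i 1)) v = bform (cvec x) v + complex_of_real t * v $ i"
proof -
  have "(\<Sum>j\<in>UNIV. complex_of_real (t * axis i 1 $ j) * v $ j) = complex_of_real t * v $ i"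
    by (simp add: axis_def if_distrib if_distribR sum.delta cong: if_cong)
  then show ?thesis
    by (simp add: bform_def cvec_def distrib_right sum.distrib)
qed

lemma bform_0_left [simp]: "bform (cvec 0) v = 0"
  by (simp add: bform_def cvec_def)

text \<open>Turns a rotation of \<open>x\<close> into a left translation of the integration
  variable, under which the Haar measure is invariant.\<close>

lemma bform_transpose:
  "bform (cvec (l *v x)) (cmat k *v \<xi>) = bform (cvec x) (cmat (transpose l ** k) *v \<xi>)"
proof -
  have "bform (cvec (l *v x)) (cmat k *v \<xi>) =
      (\<Sum>i\<in>UNIV. \<Sum>j\<in>UNIV. \<Sum>m\<in>UNIV. complex_of_real (l $ i $ j * x $ j * k $ i $ m) * \<xi> $ m)"
    by (simp add: bform_def cvec_def cmat_def matrix_vector_mult_def sum_distrib_left sum_distrib_right mult.assoc)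
       (subst sum.swap, simp)
  also have "\<dots> = (\<Sum>j\<in>UNIV. \<Sum>i\<in>UNIV. \<Sum>m\<in>UNIV. complex_of_real (l $ i $ j * x $ j * k $ i $ m) * \<xi> $ m)"
    by (rule sum.swap)
  also have "\<dots> = (\<Sum>j\<in>UNIV. \<Sum>m\<in>UNIV. \<Sum>i\<in>UNIV. complex_of_real (l $ i $ j * x $ j * k $ i $ m) * \<xi> $ m)"
    by (intro sum.cong refl sum.swap)
  also have "\<dots> = bform (cvec x) (cmat (transpose l ** k) *v \<xi>)"
    by (simp add: bform_def cvec_def cmat_def matrix_vector_mult_def matrix_matrix_mult_def transpose_def
        sum_distrib_left sum_distrib_right mult_ac)
  finally show ?thesis .
qed

text \<open>The columns of \<open>k\<close> are orthonormal for the bilinear form as well. Hence all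
  plane waves averaged in \<open>phi\<close> have the same eigenvalue.\<close>

lemma sum_square_cmat:
  fixes k :: "real^'n^'n"
  assumes "transpose k ** k = mat 1"
  shows "(\<Sum>i\<in>UNIV. ((cmat k *v \<xi>) $ i)\<^sup>2) = bform \<xi> \<xi>"
proof -
  have e: "(\<Sum>i\<in>UNIV. k $ i $ j * k $ i $ m) = (if j = m then 1 else 0)" for j m
  proof -
    have "(transpose k ** k) $ j $ m = (mat 1 :: real^'n^'n) $ j $ m" using assms by simp
    then show ?thesis by (simp add: matrix_matrix_mult_def transpose_def mat_def)
  qed
  have "(\<Sum>i\<in>UNIV. ((cmat k *v \<xi>) $ i)\<^sup>2) =
      (\<Sum>i\<in>UNIV. \<Sum>j\<in>UNIV. \<Sum>m\<in>UNIV. complex_of_real (k $ i $ j * k $ i $ m) * (\<xi> $ j * \<xi> $ m))"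
    by (simp add: power2_eq_square cmat_def matrix_vector_mult_def sum_product mult_ac)
  also have "\<dots> = (\<Sum>j\<in>UNIV. \<Sum>i\<in>UNIV. \<Sum>m\<in>UNIV. complex_of_real (k $ i $ j * k $ i $ m) * (\<xi> $ j * \<xi> $ m))"
    by (rule sum.swap)
  also have "\<dots> = (\<Sum>j\<in>UNIV. \<Sum>m\<in>UNIV. \<Sum>i\<in>UNIV. complex_of_real (k $ i $ j * k $ i $ m) * (\<xi> $ j * \<xi> $ m))"
    by (intro sum.cong refl sum.swap)
  also have "\<dots> = (\<Sum>j\<in>UNIV. \<Sum>m\<in>UNIV. complex_of_real (if j = m then 1 else 0) * (\<xi> $ j * \<xi> $ m))"
    by (simp only: e[symmetric] of_real_sum sum_distrib_right)
  also have "\<dots> = bform \<xi> \<xi>"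
    by (simp add: bform_def if_distrib if_distribR sum.delta cong: if_cong)
  finally show ?thesis .
qed

lemma continuous_on_cmat [continuous_intros]:
  "continuous_on A (\<lambda>k. (cmat k *v \<xi>) $ i)"
  unfolding cmat_def matrix_vector_mult_def by (auto intro!: continuous_intros)

lemma continuous_on_bform_cmat [continuous_intros]:
  "continuous_on A (\<lambda>k. bform v (cmat k *v \<xi>))"
  unfolding bform_def by (intro continuous_intros)

lemma radial_eigenfunction_0 [simp]: "radial_eigenfunction \<beta> 0 = 1"
  by (simp add: radial_eigenfunction_def)

section \<open>Differentiation under the integral and identification of phi\<close>

context transitive_pair
begin

text \<open>The bound |exp z - 1 - z| <= exp(|z|) |z|^2 with z = t c(k) is uniform in
  \<open>k\<close> by compactness and makes the remainder quadratic in t. The factor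
  \<open>p\<close> allows a second application to the resulting derivative.\<close>

lemma has_vector_derivative_integral_exp:
  fixes p a c :: "real^'n^'n \<Rightarrow> complex"
  assumes [continuous_intros]: "continuous_on K p" "continuous_on K a" "continuous_on K c"
  shows "((\<lambda>t. \<integral>k. p k * exp (a k + complex_of_real t * c k) \<partial>\<mu>) has_vector_derivative
          (\<integral>k. p k * c k * exp (a k) \<partial>\<mu>)) (at 0)"
proof -
  have bdd: "\<exists>M\<ge>0. \<forall>k\<in>K. norm (h k) \<le> M" if "continuous_on K h" for h :: "real^'n^'n \<Rightarrow> complex"
  proof -
    have "bounded (h ` K)"
      by (rule compact_imp_bounded[OF compact_continuous_image[OF that compact_K]])
    then show ?thesis unfolding bounded_pos by (auto intro: less_imp_le)
  qed
  have "continuous_on K (\<lambda>k. p k * exp (a k))" by (intro continuous_intros)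
  then obtain P where P: "P \<ge> 0" "\<And>k. k \<in> K \<Longrightarrow> norm (p k * exp (a k)) \<le> P"
    using bdd by blast
  obtain M where M: "M \<ge> 0" "\<And>k. k \<in> K \<Longrightarrow> norm (c k) \<le> M"
    using bdd assms(3) by blast
  show ?thesis
  proof (rule has_vector_derivative_quadratic_remainder)
    fix t :: real assume t: "\<bar>t\<bar> \<le> 1"
    let ?R = "\<lambda>k. p k * exp (a k + complex_of_real t * c k) - p k * exp (a k + complex_of_real 0 * c k)
        - t *\<^sub>R (p k * c k * exp (a k))"
    have "continuous_on K ?R" by (intro continuous_intros)
    then have int: "integrable \<mu> ?R" by (rule integrable_\<mu>_continuous)
    have bound: "norm (?R k) \<le> P * (exp M * M\<^sup>2) * t\<^sup>2" if k: "k \<in> K" for k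
    proof -
      let ?z = "complex_of_real t * c k"
      have "norm ?z \<le> \<bar>t\<bar> * M" using M(2)[OF k] by (simp add: norm_mult mult_left_mono)
      then have z: "norm ?z \<le> M" "(norm ?z)\<^sup>2 \<le> (\<bar>t\<bar> * M)\<^sup>2"
        using t M(1) mult_right_mono[OF t M(1)] by (auto intro: power_mono)
      have "norm (exp ?z - (\<Sum>j\<le>1. ?z ^ j / fact j)) \<le> exp (norm ?z) * (norm ?z) ^ Suc 1 / fact 1"
        by (rule Taylor_exp_field)
      then have "norm (exp ?z - 1 - ?z) \<le> exp (norm ?z) * (norm ?z)\<^sup>2"
        by (simp add: numeral_2_eq_2 diff_diff_eq)
      also have "\<dots> \<le> exp M * (\<bar>t\<bar> * M)\<^sup>2"
        using z by (intro mult_mono) auto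
      finally have "norm (p k * exp (a k)) * norm (exp ?z - 1 - ?z) \<le> P * (exp M * (\<bar>t\<bar> * M)\<^sup>2)"
        using P k by (intro mult_mono) auto
      moreover have "?R k = (p k * exp (a k)) * (exp ?z - 1 - ?z)"
        by (simp add: exp_add scaleR_conv_of_real algebra_simps)
      ultimately show ?thesis by (simp add: norm_mult power_mult_distrib mult_ac)
    qed
    have eq: "(\<integral>k. p k * exp (a k + complex_of_real t * c k) \<partial>\<mu>) -
        (\<integral>k. p k * exp (a k + complex_of_real 0 * c k) \<partial>\<mu>) -
        t *\<^sub>R (\<integral>k. p k * c k * exp (a k) \<partial>\<mu>) = (\<integral>k. ?R k \<partial>\<mu>)"
      by (subst Bochner_Integration.integral_diff Bochner_Integration.integral_scaleR_right;
          (intro integrable_\<mu>_continuous continuous_intros)?)+ simp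
    have "norm (\<integral>k. ?R k \<partial>\<mu>) \<le> (\<integral>k. norm (?R k) \<partial>\<mu>)" by (rule integral_norm_bound)
    also have "\<dots> \<le> P * (exp M * M\<^sup>2) * t\<^sup>2"
      using int bound by (intro integral_le_const) auto
    finally show "norm ((\<integral>k. p k * exp (a k + complex_of_real t * c k) \<partial>\<mu>) -
        (\<integral>k. p k * exp (a k + complex_of_real 0 * c k) \<partial>\<mu>) -
        t *\<^sub>R (\<integral>k. p k * c k * exp (a k) \<partial>\<mu>)) \<le> P * (exp M * M\<^sup>2) * t\<^sup>2"
      unfolding eq .
  qed
qed

lemma has_Delta_phi: "has_Delta (phi \<mu> \<xi>) x (bform \<xi> \<xi> * phi \<mu> \<xi> x)"
proof -
  let ?c = "\<lambda>i k. \<i> * (cmat k *v \<xi>) $ i"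
  let ?a = "\<lambda>y k. \<i> * bform (cvec y) (cmat k *v \<xi>)"
  define D where "D i y = (\<integral>k. ?c i k * exp (?a y k) \<partial>\<mu>)" for i y
  define H where "H i = (\<integral>k. ?c i k * ?c i k * exp (?a x k) \<partial>\<mu>)" for i
  have shift: "?a (y + t *\<^sub>R axis i 1) k = ?a y k + complex_of_real t * ?c i k" for y t i k
    by (simp add: bform_cvec_axis_shift distrib_left mult_ac)
  have "((\<lambda>t. phi \<mu> \<xi> (y + t *\<^sub>R axis i 1)) has_vector_derivative D i y) (at 0)" for i y
    using has_vector_derivative_integral_exp[of "\<lambda>_. 1" "?a y" "?c i"]
    unfolding phi_def D_def shift by (simp add: continuous_intros)
  moreover have "((\<lambda>t. D i (x + t *\<^sub>R axis i 1)) has_vector_derivative H i) (at 0)" for i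
    using has_vector_derivative_integral_exp[of "?c i" "?a x" "?c i"]
    unfolding H_def D_def shift by (simp add: continuous_intros)
  moreover have "bform \<xi> \<xi> * phi \<mu> \<xi> x = - (\<Sum>i\<in>UNIV. H i)"
  proof -
    have "(\<Sum>i\<in>UNIV. H i) = (\<integral>k. (\<Sum>i\<in>UNIV. ?c i k * ?c i k * exp (?a x k)) \<partial>\<mu>)"
      unfolding H_def
      by (rule Bochner_Integration.integral_sum[symmetric])
         (intro integrable_\<mu>_continuous continuous_intros)
    also have "\<dots> = (\<integral>k. - bform \<xi> \<xi> * exp (?a x k) \<partial>\<mu>)"
    proof (rule Bochner_Integration.integral_cong[OF refl])
      fix k assume "k \<in> space \<mu>"
      then have "(\<Sum>i\<in>UNIV. ((cmat k *v \<xi>) $ i)\<^sup>2) = bform \<xi> \<xi>"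
        by (intro sum_square_cmat transpose_mult_K) simp
      moreover have "?c i k * ?c i k = - ((cmat k *v \<xi>) $ i)\<^sup>2" for i
        by (simp add: power2_eq_square algebra_simps)
      ultimately show "(\<Sum>i\<in>UNIV. ?c i k * ?c i k * exp (?a x k)) = - bform \<xi> \<xi> * exp (?a x k)"
        by (simp add: sum_negf flip: sum_distrib_right)
    qed
    finally show ?thesis by (simp add: phi_def)
  qed
  ultimately show ?thesis unfolding has_Delta_def by blast
qed

lemma phi_radial: "norm x = norm y \<Longrightarrow> phi \<mu> \<xi> x = phi \<mu> \<xi> y"
proof -
  have "phi \<mu> \<xi> (k *v x) = phi \<mu> \<xi> x" if "k \<in> K" for k x
    unfolding phi_def bform_transpose
    by (rule integral_\<mu>_translate[where k = "transpose k"
          and h = "\<lambda>l. exp (\<i> * bform (cvec x) (cmat l *v \<xi>))"])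
       (use that transpose_K in \<open>auto intro!: continuous_intros\<close>)
  then show "norm x = norm y \<Longrightarrow> phi \<mu> \<xi> x = phi \<mu> \<xi> y"
    using radial_iff by blast
qed

lemma phi_at_0 [simp]: "phi \<mu> \<xi> 0 = 1"
  using prob_space by (simp add: phi_def)

lemma eq_radial_eigenfunction:
  fixes u :: "real^'n \<Rightarrow> complex"
  assumes "\<And>x y. norm x = norm y \<Longrightarrow> u x = u y"
    and "\<And>x. has_Delta u x (\<beta> * u x)" and "u 0 = 1"
  shows "u = radial_eigenfunction \<beta>"
proof
  fix x
  have "u x - radial_eigenfunction \<beta> x = 0"
  proof (rule radial_Helmholtz_eq_0[where u = "\<lambda>x. u x - radial_eigenfunction \<beta> x" and \<beta> = \<beta>])
    fix x y :: "real^'n" assume "norm x = norm y"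
    then show "u x - radial_eigenfunction \<beta> x = u y - radial_eigenfunction \<beta> y"
      using assms(1)[of x y] by (simp add: radial_eigenfunction_def)
  next
    fix x
    show "has_Delta (\<lambda>x. u x - radial_eigenfunction \<beta> x) x (\<beta> * (u x - radial_eigenfunction \<beta> x))"
      using has_Delta_diff[OF assms(2) has_Delta_radial_eigenfunction[OF card_gt_1]]
      by (simp add: right_diff_distrib)
  qed (simp add: assms(3))
  then show "u x = radial_eigenfunction \<beta> x" by simp
qed

text \<open>The right side involves neither \<open>K\<close> nor \<open>\<mu>\<close> and sees \<xi>
  only through b(\<xi>, \<xi>): independence of the group and the parameter of \<open>phi\<close>
  are read off here.\<close>

lemma phi_eq: "phi \<mu> \<xi> = radial_eigenfunction (bform \<xi> \<xi>)"
  by (rule eq_radial_eigenfunction[OF phi_radial has_Delta_phi phi_at_0])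

end

section \<open>Averages of plane waves are spherical\<close>

lemma continuous_on_radial_eigenfunction:
  assumes "CARD('n) > 1"
  shows "continuous_on A (radial_eigenfunction \<beta> :: real^'n \<Rightarrow> complex)"
  unfolding radial_eigenfunction_def[abs_def]
  using assms by (intro continuous_on_compose2[OF continuous_on_hyp0F1[of _ UNIV]] continuous_intros) auto

lemma continuous_on_bform_cmat_pair [continuous_intros]:
  "continuous_on A (\<lambda>z. bform (cvec (fst z)) (cmat (snd z) *v \<xi>))"
  "continuous_on A (\<lambda>z. bform v (cmat (snd z) *v \<xi>))"
  unfolding bform_def cvec_def cmat_def matrix_vector_mult_def by (auto intro!: continuous_intros)

context transitive_pair
begin

text \<open>Right invariance removes the rotation coordinate; left invariance then makes the
  remaining function invariant under \<open>K\<close>. Its support lies in the projection of a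
  compact set.\<close>

lemma bi_invariant_reduce:
  assumes cont: "continuous_on (UNIV \<times> K) f" and supp: "compactly_supported K f"
    and inv: "bi_invariant K f"
  obtains f0 S where "continuous_on UNIV f0" "compact S" "\<And>y. y \<notin> S \<Longrightarrow> f0 y = 0"
    "\<And>y k. k \<in> K \<Longrightarrow> f (y, k) = f0 y" "\<And>y k. k \<in> K \<Longrightarrow> f0 (k *v y) = f0 y"
proof -
  define f0 where "f0 y = f (y, mat 1)" for y
  have inv': "f ((0, k) \<otimes>\<^bsub>motion_group K\<^esub> (y, m) \<otimes>\<^bsub>motion_group K\<^esub> (0, l)) = f (y, m)"
    if "k \<in> K" "l \<in> K" "m \<in> K" for k l m y
    using inv that unfolding bi_invariant_def by auto
  have f: "f (y, k) = f0 y" if "k \<in> K" for y k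
    using inv'[OF one_K that one_K, of y] by (simp add: f0_def)
  obtain C where C: "compact C" "C \<subseteq> UNIV \<times> K" "\<And>g. g \<in> UNIV \<times> K - C \<Longrightarrow> f g = 0"
    using supp unfolding compactly_supported_def by auto
  show ?thesis
  proof
    show "continuous_on UNIV f0" unfolding f0_def
      by (rule continuous_on_compose2[OF cont]) (auto intro!: continuous_intros one_K)
    show "compact (fst ` C)" by (rule compact_continuous_image[OF _ C(1)]) (intro continuous_intros)
    show "f0 y = 0" if "y \<notin> fst ` C" for y
      unfolding f0_def using that one_K by (intro C(3)) (auto simp: image_iff)
    show "f0 (k *v y) = f0 y" if "k \<in> K" for y k
    proof -
      have "f0 (k *v y) = f (k *v y, k)" using f[OF that] by simp
      also have "\<dots> = f0 y" using inv'[OF that one_K one_K, of y] by (simp add: f0_def)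
      finally show ?thesis .
    qed
  qed (rule f)
qed

text \<open>Convolution with f multiplies the plane wave of frequency k(\<xi>) by the Fourier
  transform of \<open>f0\<close> at k(\<xi>). This factor turns out not to depend on k, so it
  survives averaging over \<open>K\<close>.\<close>

lemma spherical_phi: "spherical K \<mu> (lift (phi \<mu> \<xi>))"
proof -
  have cont_phi: "continuous_on A (phi \<mu> \<xi>)" for A
    unfolding phi_eq by (rule continuous_on_radial_eigenfunction[OF card_gt_1])
  have radial: "\<forall>x y. norm x = norm y \<longrightarrow> phi \<mu> \<xi> x = phi \<mu> \<xi> y"
    using phi_radial by blast
  have "\<exists>ev. \<forall>g\<in>UNIV \<times> K. convolution K \<mu> f (lift (phi \<mu> \<xi>)) g = ev * lift (phi \<mu> \<xi>) g"
    if f: "continuous_on (UNIV \<times> K) f" "compactly_supported K f" "bi_invariant K f" for f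
  proof -
    obtain f0 S where f0: "continuous_on UNIV f0" and S: "compact S" "\<And>y. y \<notin> S \<Longrightarrow> f0 y = 0"
      and ff0: "\<And>y k. k \<in> K \<Longrightarrow> f (y, k) = f0 y" and f0K: "\<And>y k. k \<in> K \<Longrightarrow> f0 (k *v y) = f0 y"
      using bi_invariant_reduce[OF f] by blast
    let ?B = "\<lambda>y k. bform (cvec y) (cmat k *v \<xi>)"
    have B_diff: "?B (x - y) k = ?B x k - ?B y k" for x y k
      by (simp add: bform_def cvec_def left_diff_distrib sum_subtractf)
    define ev where "ev = (\<integral>y. f0 y * exp (- \<i> * ?B y (mat 1)) \<partial>lborel)"
    \<comment> \<open>The substitution of k y for y preserves Lebesgue measure and
      \<open>f0\<close>, and b(k y, k \<xi>) = b(y, \<xi>).\<close>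
    have inner: "(\<integral>y. f0 y * exp (- \<i> * ?B y k) \<partial>lborel) = ev" if k: "k \<in> K" for k
    proof -
      have [measurable]: "(\<lambda>x. k *v x) \<in> borel_measurable borel"
        by (intro borel_measurable_continuous_onI continuous_intros)
      have meas: "(\<lambda>y. f0 y * exp (- \<i> * ?B y k)) \<in> borel_measurable borel"
        unfolding bform_def cvec_def
        by (intro borel_measurable_continuous_onI continuous_intros f0)
      have "(\<integral>y. f0 y * exp (- \<i> * ?B y k) \<partial>lborel) =
          (\<integral>y. f0 y * exp (- \<i> * ?B y k) \<partial>distr lborel borel (\<lambda>x. k *v x))"
        by (simp add: distr_lborel_linear_isometry[OF orthogonal_transformation_K[OF k]])
      also have "\<dots> = (\<integral>y. f0 (k *v y) * exp (- \<i> * ?B (k *v y) k) \<partial>lborel)"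
        by (rule integral_distr[OF _ meas]) simp
      finally show ?thesis
        by (simp add: ev_def f0K[OF k] bform_transpose transpose_mult_K[OF k])
    qed
    have "convolution K \<mu> f (lift (phi \<mu> \<xi>)) (x, l) = ev * phi \<mu> \<xi> x" for x l
    proof -
      let ?F = "\<lambda>y k. f0 y * (exp (\<i> * ?B x k) * exp (- \<i> * ?B y k))"
      have contF: "continuous_on A (\<lambda>z. case_prod ?F z)" for A
        unfolding case_prod_unfold
        by (intro continuous_intros continuous_on_compose2[OF f0]) auto
      have "bounded (case_prod ?F ` (S \<times> K))"
        by (intro compact_imp_bounded compact_continuous_image contF compact_Times S(1) compact_K)
      then obtain M where M: "\<And>z. z \<in> S \<times> K \<Longrightarrow> norm (case_prod ?F z) \<le> M"
        unfolding bounded_iff by blast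
      \<comment> \<open>For non-real \<xi> the exponentials are unbounded in y. The compact support
        of \<open>f0\<close> saves Fubini: the integrand is bounded on \<open>S \<times> K\<close>,
        a set of finite measure, and zero outside.\<close>
      have int: "integrable (lborel \<Otimes>\<^sub>M \<mu>) (case_prod ?F)"
      proof (rule integrableI_bounded_set)
        have "(\<lambda>z. (fst z, snd z)) \<in> measurable (lborel \<Otimes>\<^sub>M \<mu>) (borel \<Otimes>\<^sub>M borel)"
          using measurable_compose[OF measurable_snd measurable_\<mu>_continuous[OF continuous_on_id]]
          by (intro measurable_Pair) auto
        then have id: "(\<lambda>z. z) \<in> measurable (lborel \<Otimes>\<^sub>M \<mu>) borel"
          by (simp add: borel_prod)
        show "case_prod ?F \<in> borel_measurable (lborel \<Otimes>\<^sub>M \<mu>)"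
          using measurable_compose[OF id borel_measurable_continuous_onI[OF contF]] by simp
        have SK: "S \<in> sets lborel" "K \<in> sets \<mu>"
          using borel_closed[OF compact_imp_closed[OF S(1)]] sets.top[of \<mu>] by auto
        show "S \<times> K \<in> sets (lborel \<Otimes>\<^sub>M \<mu>)" using SK by simp
        have "emeasure (lborel \<Otimes>\<^sub>M \<mu>) (S \<times> K) = emeasure lborel S * emeasure \<mu> K"
          by (rule emeasure_pair_measure_Times[OF SK])
        then show "emeasure (lborel \<Otimes>\<^sub>M \<mu>) (S \<times> K) < \<infinity>"
          using emeasure_compact_finite[OF S(1)] by (simp add: emeasure_\<mu>)
        show "AE z in lborel \<Otimes>\<^sub>M \<mu>. z \<in> S \<times> K \<longrightarrow> norm (case_prod ?F z) \<le> M"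
          using M by (intro AE_I2) blast
        show "AE z in lborel \<Otimes>\<^sub>M \<mu>. z \<notin> S \<times> K \<longrightarrow> case_prod ?F z = 0"
          using S(2) by (intro AE_I2) (fastforce simp: space_pair_measure)
      qed
      interpret P: pair_sigma_finite "lborel :: (real^'n) measure" \<mu> ..
      have "convolution K \<mu> f (lift (phi \<mu> \<xi>)) (x, l) = (\<integral>y. f0 y * phi \<mu> \<xi> (x - y) \<partial>lborel)"
        by (rule convolution_eq[OF radial ff0 f0 cont_phi])
      also have "\<dots> = (\<integral>y. (\<integral>k. ?F y k \<partial>\<mu>) \<partial>lborel)"
      proof (rule Bochner_Integration.integral_cong[OF refl])
        fix y
        have "(\<integral>k. ?F y k \<partial>\<mu>) = f0 y * (\<integral>k. exp (\<i> * ?B x k) * exp (- \<i> * ?B y k) \<partial>\<mu>)"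
          by (rule integral_mult_right_zero)
        then show "f0 y * phi \<mu> \<xi> (x - y) = (\<integral>k. ?F y k \<partial>\<mu>)"
          by (simp add: phi_def B_diff right_diff_distrib exp_diff exp_minus divide_inverse)
      qed
      also have "\<dots> = (\<integral>k. (\<integral>y. ?F y k \<partial>lborel) \<partial>\<mu>)"
        by (rule P.Fubini_integral[OF int, symmetric])
      also have "\<dots> = (\<integral>k. ev * exp (\<i> * ?B x k) \<partial>\<mu>)"
      proof (rule Bochner_Integration.integral_cong[OF refl])
        fix k assume "k \<in> space \<mu>"
        then have "k \<in> K" by simp
        have "(\<integral>y. ?F y k \<partial>lborel) = (\<integral>y. exp (\<i> * ?B x k) * (f0 y * exp (- \<i> * ?B y k)) \<partial>lborel)"
          by (simp add: mult_ac)
        also have "\<dots> = exp (\<i> * ?B x k) * ev"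
          unfolding integral_mult_right_zero inner[OF \<open>k \<in> K\<close>] ..
        finally show "(\<integral>y. ?F y k \<partial>lborel) = ev * exp (\<i> * ?B x k)" by simp
      qed
      also have "\<dots> = ev * phi \<mu> \<xi> x" by (simp add: phi_def)
      finally show ?thesis .
    qed
    then show ?thesis by (intro exI[of _ ev]) auto
  qed
  moreover have "continuous_on (UNIV \<times> K) (lift (phi \<mu> \<xi>))"
    unfolding lift_def by (rule continuous_on_compose2[OF cont_phi]) (auto intro!: continuous_intros)
  ultimately show ?thesis
    unfolding spherical_def bi_invariant_lift_iff motion_group_simps lift_simp phi_at_0
    using radial by blast
qed

end

section \<open>Spherical functions are eigenfunctions\<close>

text \<open>Passes from the Lebesgue integral to the gauge integral, for which the Leibniz rule and
  the vanishing criterion for nonnegative continuous integrands will be used.\<close>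

lemma integral_lborel_cbox:
  fixes h :: "'a::euclidean_space \<Rightarrow> 'b::euclidean_space"
  assumes cont: "continuous_on UNIV h" and supp: "\<And>y. y \<notin> cbox a b \<Longrightarrow> h y = 0"
  shows "integrable lborel h" "(\<integral>y. h y \<partial>lborel) = integral (cbox a b) h"
proof -
  have eq: "(\<lambda>y. indicator (cbox a b) y *\<^sub>R h y) = h"
    using supp by (auto simp: indicator_def)
  have int: "set_integrable lborel (cbox a b) h"
    unfolding set_integrable_def
    by (rule borel_integrable_compact) (use cont continuous_on_subset in auto)
  then show "integrable lborel h" by (simp add: set_integrable_def eq)
  from set_borel_integral_eq_integral(2)[OF int]
  show "(\<integral>y. h y \<partial>lborel) = integral (cbox a b) h"
    by (simp add: set_lebesgue_integral_def eq)
qed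

text \<open>Serves to move the variable \<open>x\<close> of a convolution from the spherical
  function to the other factor, which can be differentiated.\<close>

lemma integral_lborel_reflect:
  fixes h :: "'a::euclidean_space \<Rightarrow> complex"
  assumes [measurable]: "h \<in> borel_measurable borel"
  shows "(\<integral>y. h (x - y) \<partial>lborel) = (\<integral>y. h y \<partial>lborel)"
proof -
  have "orthogonal_transformation (uminus :: 'a \<Rightarrow> 'a)"
    by (auto simp: orthogonal_transformation_def intro!: linearI)
  then have "distr lborel borel (uminus :: 'a \<Rightarrow> 'a) = lborel"
    by (rule distr_lborel_linear_isometry)
  then have "(\<integral>y. h (x + y) \<partial>lborel) = (\<integral>y. h (x + y) \<partial>distr lborel borel (uminus :: 'a \<Rightarrow> 'a))"
    by simp
  also have "\<dots> = (\<integral>y. h (x - y) \<partial>lborel)"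
    by (subst integral_distr) auto
  finally have "(\<integral>y. h (x - y) \<partial>lborel) = (\<integral>y. h (x + y) \<partial>lborel)" by simp
  also have "\<dots> = (\<integral>y. h y \<partial>distr lborel borel ((+) x))"
    by (subst integral_distr) auto
  finally show ?thesis by (simp add: lborel_distr_plus)
qed

text \<open>The derivative falls on \<open>f\<close>, so continuity of \<open>\<psi>\<close>
  suffices. For |t| <= 1 all shifted supports stay in the ball of radius R + |e| about x, so one
  fixed box carries the integrals and the Leibniz rule applies.\<close>

lemma has_vector_derivative_convolution:
  fixes f f' \<psi> :: "real^'n \<Rightarrow> complex" and e :: "real^'n"
  assumes cont: "continuous_on UNIV f" "continuous_on UNIV f'" "continuous_on UNIV \<psi>"
    and supp: "\<And>z. norm z \<ge> R \<Longrightarrow> f z = 0" "\<And>z. norm z \<ge> R \<Longrightarrow> f' z = 0"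
    and deriv: "\<And>z. ((\<lambda>t. f (z + t *\<^sub>R e)) has_vector_derivative f' z) (at 0)"
  shows "((\<lambda>t. \<integral>y. f (x + t *\<^sub>R e - y) * \<psi> y \<partial>lborel) has_vector_derivative
          (\<integral>y. f' (x - y) * \<psi> y \<partial>lborel)) (at 0)"
proof -
  have "bounded (cball x (R + norm e))" by simp
  then obtain a b where ab: "cball x (R + norm e) \<subseteq> cbox a b"
    using bounded_subset_cbox_symmetric by metis
  have far: "norm (x + t *\<^sub>R e - y) \<ge> R" if "y \<notin> cbox a b" "\<bar>t\<bar> \<le> 1" for y t
  proof -
    have "dist x y > R + norm e" using that(1) ab by (meson mem_cball not_le subsetD)
    moreover have "norm (t *\<^sub>R e) \<le> norm e" using that(2) by (simp add: mult_left_le_one_le)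
    moreover have "norm (x - y) \<le> norm (x + t *\<^sub>R e - y) + norm (t *\<^sub>R e)"
      using norm_triangle_ineq4[of "x + t *\<^sub>R e - y" "t *\<^sub>R e"] by simp
    ultimately show ?thesis by (simp add: dist_norm)
  qed
  have c1: "continuous_on A (\<lambda>y. f (x + t *\<^sub>R e - y) * \<psi> y)" for t A
    by (intro continuous_intros continuous_on_compose2[OF cont(1)] continuous_on_subset[OF cont(3)]) auto
  have c2: "continuous_on A (\<lambda>y. f' (x - y) * \<psi> y)" for A
    by (intro continuous_intros continuous_on_compose2[OF cont(2)] continuous_on_subset[OF cont(3)]) auto
  have i1: "(\<integral>y. f (x + t *\<^sub>R e - y) * \<psi> y \<partial>lborel) = integral (cbox a b) (\<lambda>y. f (x + t *\<^sub>R e - y) * \<psi> y)"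
    if "\<bar>t\<bar> \<le> 1" for t
    by (rule integral_lborel_cbox(2)[OF c1]) (use far that supp(1) in auto)
  have i2: "(\<integral>y. f' (x - y) * \<psi> y \<partial>lborel) = integral (cbox a b) (\<lambda>y. f' (x - y) * \<psi> y)"
    by (rule integral_lborel_cbox(2)[OF c2]) (use far[where t = 0] supp(2) in auto)
  have "((\<lambda>t. integral (cbox a b) (\<lambda>y. f (x + t *\<^sub>R e - y) * \<psi> y)) has_vector_derivative
      integral (cbox a b) (\<lambda>y. f' (x + 0 *\<^sub>R e - y) * \<psi> y)) (at 0 within {-1..1})"
  proof (rule leibniz_rule_vector_derivative[where fx = "\<lambda>t y. f' (x + t *\<^sub>R e - y) * \<psi> y"])
    fix t y
    have "((\<lambda>s. f ((x + t *\<^sub>R e - y) + s *\<^sub>R e)) has_vector_derivative f' (x + t *\<^sub>R e - y)) (at 0)"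
      by (rule deriv)
    then have "((\<lambda>s. f (x + (t + s) *\<^sub>R e - y)) has_vector_derivative f' (x + t *\<^sub>R e - y)) (at 0)"
      by (simp add: scaleR_add_left algebra_simps)
    from has_vector_derivative_mult_left[OF has_vector_derivative_translate[OF this]]
    show "((\<lambda>t. f (x + t *\<^sub>R e - y) * \<psi> y) has_vector_derivative f' (x + t *\<^sub>R e - y) * \<psi> y)
        (at t within {-1..1})"
      by (rule has_vector_derivative_at_within)
  next
    fix t :: real
    show "(\<lambda>y. f (x + t *\<^sub>R e - y) * \<psi> y) integrable_on cbox a b"
      by (rule integrable_continuous[OF c1])
  next
    show "continuous_on ({-1..1} \<times> cbox a b) (\<lambda>(t, y). f' (x + t *\<^sub>R e - y) * \<psi> y)"
      unfolding case_prod_unfold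
      by (intro continuous_intros continuous_on_compose2[OF cont(2)] continuous_on_compose2[OF cont(3)]) auto
  qed auto
  then have "((\<lambda>t. integral (cbox a b) (\<lambda>y. f (x + t *\<^sub>R e - y) * \<psi> y)) has_vector_derivative
      (\<integral>y. f' (x - y) * \<psi> y \<partial>lborel)) (at 0)"
    by (simp add: i2 at_within_Icc_at)
  then show ?thesis
    by (rule has_vector_derivative_transform_within_open[where S = "{-1<..<1}"]) (auto simp: i1)
qed

text \<open>The exponent is at least 2, so at the kink the remainder is quadratic.\<close>

lemma has_real_derivative_max_power:
  "((\<lambda>s::real. (max 0 s) ^ Suc (Suc n)) has_real_derivative real (Suc (Suc n)) * (max 0 s) ^ Suc n) (at s)"
proof -
  consider "s > 0" | "s < 0" | "s = 0" by linarith
  then show ?thesis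
  proof cases
    case 1
    have "((\<lambda>s::real. s ^ Suc (Suc n)) has_real_derivative real (Suc (Suc n)) * s ^ Suc n) (at s)"
      using DERIV_pow[of "Suc (Suc n)" s] by simp
    then have "((\<lambda>s::real. (max 0 s) ^ Suc (Suc n)) has_real_derivative real (Suc (Suc n)) * s ^ Suc n) (at s)"
      by (rule has_field_derivative_transform_within_open[where S = "{0<..}"]) (use 1 in auto)
    then show ?thesis using 1 by simp
  next
    case 2
    have "((\<lambda>s::real. 0::real) has_real_derivative 0) (at s)" by simp
    then have "((\<lambda>s::real. (max 0 s) ^ Suc (Suc n)) has_real_derivative 0) (at s)"
      by (rule has_field_derivative_transform_within_open[where S = "{..<0}"]) (use 2 in auto)
    then show ?thesis using 2 by simp
  next
    case 3
    have "((\<lambda>s::real. (max 0 s) ^ Suc (Suc n)) has_vector_derivative 0) (at 0)"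
    proof (rule has_vector_derivative_quadratic_remainder[where C = 1])
      fix t :: real assume "\<bar>t\<bar> \<le> 1"
      then have "(max 0 t) ^ Suc (Suc n) \<le> (max 0 t)\<^sup>2"
        by (intro power_decreasing) auto
      also have "\<dots> \<le> t\<^sup>2" by (auto simp: max_def)
      finally show "norm ((max 0 t) ^ Suc (Suc n) - (max 0 0) ^ Suc (Suc n) - t *\<^sub>R 0) \<le> 1 * t\<^sup>2"
        by simp
    qed
    then show ?thesis using 3 by (simp add: has_real_derivative_iff_has_vector_derivative)
  qed
qed

context transitive_pair
begin

text \<open>Convolving with the compactly supported \<open>C\<^sup>2\<close> function \<open>(R\<^sup>2 - |z|\<^sup>2)\<^sub>+\<^sup>3\<close>, and with its
  Laplacian, which is again radial, shows that a spherical function is smooth enough and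
  an eigenfunction of the Laplacian.\<close>

lemma spherical_has_Delta:
  assumes sph: "spherical K \<mu> (lift \<psi>)"
  obtains \<beta> where "\<And>x. has_Delta \<psi> x (\<beta> * \<psi> x)"
proof -
  have radial: "\<forall>x y. norm x = norm y \<longrightarrow> \<psi> x = \<psi> y"
    using sph unfolding spherical_def bi_invariant_lift_iff by blast
  have \<psi>0: "\<psi> 0 = 1" using sph by (simp add: spherical_def)
  have cont\<psi>: "continuous_on UNIV \<psi>"
  proof -
    have "continuous_on (UNIV \<times> K) (lift \<psi>)" using sph by (simp add: spherical_def)
    then have "continuous_on UNIV (\<lambda>y. lift \<psi> (y, mat 1))"
      by (rule continuous_on_compose2) (auto intro!: continuous_intros one_K)
    then show ?thesis by simp
  qed
  define conv where "conv g x = (\<integral>y. g (x - y) * \<psi> y \<partial>lborel)" for g x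
  have meas: "(\<lambda>y. g (x - y) * \<psi> y) \<in> borel_measurable borel" "(\<lambda>y. g y * \<psi> (x - y)) \<in> borel_measurable borel"
    if "continuous_on UNIV g" for g x
    by (intro borel_measurable_continuous_onI continuous_intros continuous_on_compose2[OF that]
        continuous_on_compose2[OF cont\<psi>]; auto)+
  have int: "integrable lborel (\<lambda>y. g (x - y) * \<psi> y)"
    if g: "continuous_on UNIV g" "\<And>z. norm z \<ge> R \<Longrightarrow> g z = 0" for g x R
  proof -
    have "bounded (cball x R)" by simp
    then obtain a b where ab: "cball x R \<subseteq> cbox a b"
      using bounded_subset_cbox_symmetric by metis
    show ?thesis
    proof (rule integral_lborel_cbox(1))
      show "continuous_on UNIV (\<lambda>y. g (x - y) * \<psi> y)"
        by (intro continuous_intros continuous_on_compose2[OF g(1)] cont\<psi>) auto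
      fix y assume "y \<notin> cbox a b"
      then have "norm (x - y) \<ge> R" using ab by (force simp: dist_norm)
      then show "g (x - y) * \<psi> y = 0" using g(2) by simp
    qed
  qed
  have eigen: "\<exists>ev. \<forall>x. conv g x = ev * \<psi> x"
    if g: "continuous_on UNIV g" "\<And>z. norm z \<ge> R \<Longrightarrow> g z = 0" "\<forall>x y. norm x = norm y \<longrightarrow> g x = g y" for g R
  proof -
    have "continuous_on (UNIV \<times> K) (lift g)"
      unfolding lift_def by (rule continuous_on_compose2[OF g(1)]) (auto intro!: continuous_intros)
    moreover have "compactly_supported K (lift g)"
      unfolding compactly_supported_def
      by (rule exI[of _ "cball 0 R \<times> K"]) (auto intro!: compact_Times compact_K g(2))
    moreover have "bi_invariant K (lift g)" using g(3) unfolding bi_invariant_lift_iff .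
    ultimately obtain ev where ev: "\<And>h. h \<in> UNIV \<times> K \<Longrightarrow> convolution K \<mu> (lift g) (lift \<psi>) h = ev * lift \<psi> h"
      using sph unfolding spherical_def motion_group_simps by blast
    have "conv g x = ev * \<psi> x" for x
    proof -
      have "convolution K \<mu> (lift g) (lift \<psi>) (x, mat 1) = (\<integral>y. g y * \<psi> (x - y) \<partial>lborel)"
        by (rule convolution_eq[OF radial _ g(1) cont\<psi>]) simp
      also have "\<dots> = conv g x"
        using integral_lborel_reflect[OF meas(2)[OF g(1)], of x x] by (simp add: conv_def)
      finally show ?thesis using ev[of "(x, mat 1)"] one_K by simp
    qed
    then show ?thesis by blast
  qed
  \<comment> \<open>The radius is chosen with Re \<open>\<psi>\<close> > 0 inside, so that
    convolution with the bump cannot annihilate \<open>\<psi>\<close>.\<close>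
  obtain R where R: "R > 0" "\<And>y. norm y < R \<Longrightarrow> Re (\<psi> y) > 0"
  proof -
    have "isCont \<psi> 0" using cont\<psi> by (simp add: continuous_on_eq_continuous_at)
    then obtain R where R: "R > 0" "\<And>y. dist y 0 < R \<Longrightarrow> dist (\<psi> y) (\<psi> 0) < 1"
      unfolding continuous_at_eps_delta by (meson zero_less_one)
    have "Re (\<psi> y) > 0" if "norm y < R" for y
    proof -
      have "norm (1 - \<psi> y) < 1" using R(2)[of y] that by (simp add: \<psi>0 dist_norm norm_minus_commute)
      then show ?thesis using complex_Re_le_cmod[of "1 - \<psi> y"] by simp
    qed
    then show ?thesis using that R(1) by blast
  qed
  define m where "m z = max 0 (R\<^sup>2 - (norm z)\<^sup>2)" for z :: "real^'n"
  have m0: "m z = 0" if "norm z \<ge> R" for z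
    using that R(1) by (simp add: m_def power_mono)
  have contm [continuous_intros]: "continuous_on A m" for A
    unfolding m_def by (intro continuous_intros)
  have m_deriv: "((\<lambda>t. complex_of_real (m (z + t *\<^sub>R axis i 1) ^ Suc (Suc n))) has_vector_derivative
      complex_of_real (- 2 * real (Suc (Suc n)) * z $ i * m z ^ Suc n)) (at 0)" for z i n
  proof -
    have "((\<lambda>t. R\<^sup>2 - ((norm z)\<^sup>2 + 2 * t * z $ i + t\<^sup>2)) has_real_derivative - 2 * z $ i) (at 0)"
      by (auto intro!: derivative_eq_intros)
    from DERIV_chain2[OF has_real_derivative_max_power[of n] this]
    have "((\<lambda>t. m (z + t *\<^sub>R axis i 1) ^ Suc (Suc n)) has_real_derivative
        real (Suc (Suc n)) * m z ^ Suc n * (- 2 * z $ i)) (at 0)"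
      unfolding m_def norm_squared_axis_shift by simp
    then have "((\<lambda>t. m (z + t *\<^sub>R axis i 1) ^ Suc (Suc n)) has_real_derivative
        - 2 * real (Suc (Suc n)) * z $ i * m z ^ Suc n) (at 0)"
      by (rule DERIV_cong) (simp add: algebra_simps)
    then show ?thesis by (rule has_vector_derivative_of_real)
  qed
  \<comment> \<open>The cube is the least integer power whose second derivatives, of first order in
    \<open>m\<close>, are still continuous at the boundary of the ball.\<close>
  define f where "f z = complex_of_real (m z ^ 3)" for z
  define f' where "f' i z = complex_of_real (- 6 * z $ i * m z ^ 2)" for i z
  define f'' where "f'' i z = complex_of_real (- 6 * m z ^ 2 + 24 * (z $ i)\<^sup>2 * m z)" for i z
  define F where "F z = (\<Sum>i\<in>UNIV. f'' i z)" for z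
  have cont: "continuous_on UNIV f" "continuous_on UNIV (f' i)" "continuous_on UNIV (f'' i)"
    "continuous_on UNIV F" for i
    unfolding f_def f'_def f''_def F_def by (intro continuous_intros)+
  have supp: "f z = 0" "f' i z = 0" "f'' i z = 0" "F z = 0" if "norm z \<ge> R" for i z
    using m0[OF that] by (simp_all add: f_def f'_def f''_def F_def)
  have radial_f: "\<forall>x y. norm x = norm y \<longrightarrow> f x = f y" by (simp add: f_def m_def)
  \<comment> \<open>A single \<open>f'' i\<close> is not radial; summation turns the squares of the
    coordinates into |z|^2. Only the sum can therefore be used as a test function.\<close>
  have radial_F: "\<forall>x y. norm x = norm y \<longrightarrow> F x = F y"
  proof -
    have "F z = complex_of_real (- 6 * CARD('n) * m z ^ 2 + 24 * (norm z)\<^sup>2 * m z)" for z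
    proof -
      have "(norm z)\<^sup>2 = (\<Sum>i\<in>UNIV. (z $ i)\<^sup>2)"
        unfolding power2_norm_eq_inner by (simp add: inner_vec_def power2_eq_square)
      then show ?thesis
        unfolding F_def f''_def of_real_sum[symmetric]
        by (simp add: sum.distrib sum_subtractf sum_distrib_left sum_distrib_right sum_negf)
    qed
    then show ?thesis by (simp add: m_def)
  qed
  have df: "((\<lambda>t. f (z + t *\<^sub>R axis i 1)) has_vector_derivative f' i z) (at 0)" for z i
    using m_deriv[of z i 1] by (simp add: f_def f'_def numeral_3_eq_3 numeral_2_eq_2)
  have df': "((\<lambda>t. f' i (z + t *\<^sub>R axis i 1)) has_vector_derivative f'' i z) (at 0)" for z i
  proof -
    have "((\<lambda>t. complex_of_real (- 6 * (z $ i + t))) has_vector_derivative complex_of_real (- 6)) (at 0)"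
      by (rule has_vector_derivative_of_real)
         (auto intro!: derivative_eq_intros)
    from has_vector_derivative_mult[OF this m_deriv[of z i 0]]
    show ?thesis
      by (simp add: f'_def f''_def axis_def power2_eq_square numeral_2_eq_2 algebra_simps)
  qed
  obtain ev1 where ev1: "\<And>x. conv f x = ev1 * \<psi> x" using eigen[OF cont(1) supp(1) radial_f] by blast
  obtain ev2 where ev2: "\<And>x. conv F x = ev2 * \<psi> x" using eigen[OF cont(4) supp(4) radial_F] by blast
  \<comment> \<open>Otherwise the nonnegative continuous function
    \<open>m y ^ 3 * Re (\<psi> y)\<close> has integral 0 and vanishes identically, although its
    value at 0 is R^6.\<close>
  have "ev1 \<noteq> 0"
  proof
    assume "ev1 = 0"
    then have "conv f 0 = 0" by (simp add: ev1)
    moreover have "integrable lborel (\<lambda>y. f (0 - y) * \<psi> y)"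
      by (rule int[OF cont(1) supp(1)])
    ultimately have "(\<integral>y. Re (f (0 - y) * \<psi> y) \<partial>lborel) = 0"
      by (subst integral_Re) (simp_all add: conv_def)
    then have zero: "(\<integral>y. m y ^ 3 * Re (\<psi> y) \<partial>lborel) = 0"
      by (simp add: f_def m_def)
    have "bounded (cball (0::real^'n) R)" by simp
    then obtain a where ab: "cball (0::real^'n) R \<subseteq> cbox (-a) a"
      using bounded_subset_cbox_symmetric by metis
    have cont_m: "continuous_on A (\<lambda>y. m y ^ 3 * Re (\<psi> y))" for A
      by (intro continuous_intros continuous_on_subset[OF cont\<psi>]) auto
    have "(\<integral>y. m y ^ 3 * Re (\<psi> y) \<partial>lborel) = integral (cbox (-a) a) (\<lambda>y. m y ^ 3 * Re (\<psi> y))"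
    proof (rule integral_lborel_cbox(2)[OF cont_m])
      fix y assume "y \<notin> cbox (-a) a"
      then have "norm y \<ge> R" using ab by (force simp: dist_norm)
      then show "m y ^ 3 * Re (\<psi> y) = 0" by (simp add: m0)
    qed
    moreover have "box (-a) a \<noteq> {}"
    proof -
      have "ball (0::real^'n) R \<subseteq> interior (cbox (-a) a)"
        using ab by (intro interior_maximal) (auto simp: subset_iff)
      moreover have "(0::real^'n) \<in> ball 0 R" using R(1) by simp
      ultimately show ?thesis by (metis empty_iff interior_cbox subsetD)
    qed
    moreover have "m y ^ 3 * Re (\<psi> y) \<ge> 0" for y
    proof (cases "norm y < R")
      case True
      then show ?thesis using R(2)[of y] by (simp add: m_def)
    qed (simp add: m0)
    ultimately have "\<forall>y\<in>cbox (-a) a. m y ^ 3 * Re (\<psi> y) = 0"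
      using zero integral_cbox_eq_0_iff[OF cont_m, of "-a" a] by simp
    moreover have "0 \<in> cbox (-a) a" using ab R(1) by (auto simp: subset_iff)
    ultimately have "m 0 ^ 3 * Re (\<psi> 0) = 0" by blast
    then show False using R(1) by (simp add: m_def \<psi>0)
  qed
  then have \<psi>_conv: "\<psi> = (\<lambda>x. inverse ev1 * conv f x)"
    by (intro ext) (simp add: ev1 field_simps)
  \<comment> \<open>The second derivatives of \<open>\<psi>\<close> add up to \<open>conv F\<close>
    divided by \<open>ev1\<close>, that is to (ev2/ev1) \<open>\<psi>\<close>; the minus sign is the
    one in \<Delta>.\<close>
  have "has_Delta \<psi> x (- (ev2 / ev1) * \<psi> x)" for x
    unfolding has_Delta_def
  proof (intro exI conjI allI)
    fix i y
    show "((\<lambda>t. \<psi> (y + t *\<^sub>R axis i 1)) has_vector_derivative inverse ev1 * conv (f' i) y) (at 0)"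
      by (subst \<psi>_conv, rule has_vector_derivative_mult_right, unfold conv_def)
         (rule has_vector_derivative_convolution[OF cont(1,2) cont\<psi> supp(1,2) df])
  next
    fix i
    show "((\<lambda>t. inverse ev1 * conv (f' i) (x + t *\<^sub>R axis i 1)) has_vector_derivative
        inverse ev1 * conv (f'' i) x) (at 0)"
      by (rule has_vector_derivative_mult_right, unfold conv_def)
         (rule has_vector_derivative_convolution[OF cont(2,3) cont\<psi> supp(2,3) df'])
  next
    have "(\<Sum>i\<in>UNIV. conv (f'' i) x) = conv F x"
      unfolding conv_def F_def sum_distrib_right
      by (rule Bochner_Integration.integral_sum[symmetric]) (rule int[OF cont(3) supp(3)])
    then show "- (ev2 / ev1) * \<psi> x = - (\<Sum>i\<in>UNIV. inverse ev1 * conv (f'' i) x)"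
      by (simp add: ev2 divide_inverse flip: sum_distrib_left)
  qed
  then show ?thesis by (rule that)
qed

lemma spherical_eq_radial_eigenfunction:
  assumes "spherical K \<mu> (lift \<psi>)"
  obtains \<beta> where "\<psi> = radial_eigenfunction \<beta>"
proof -
  obtain \<beta> where \<beta>: "\<And>x. has_Delta \<psi> x (\<beta> * \<psi> x)" using spherical_has_Delta[OF assms] by blast
  have "bi_invariant K (lift \<psi>)" "\<psi> 0 = 1" using assms by (simp_all add: spherical_def)
  then have "\<psi> = radial_eigenfunction \<beta>"
    unfolding bi_invariant_lift_iff by (intro eq_radial_eigenfunction \<beta>) blast+
  then show ?thesis by (rule that)
qed

end

section \<open>Positive definite spherical functions\<close>

text \<open>Both functions are 1 at 0, so each parameter is the value of \<Delta> at 0, and that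
  value is unique.\<close>

lemma radial_eigenfunction_inj:
  assumes n: "CARD('n) > 1"
    and eq: "radial_eigenfunction \<beta> = (radial_eigenfunction \<gamma> :: real^'n \<Rightarrow> complex)"
  shows "\<beta> = \<gamma>"
proof -
  have "has_Delta (radial_eigenfunction \<beta> :: real^'n \<Rightarrow> complex) 0 (\<beta> * radial_eigenfunction \<beta> (0::real^'n))"
    by (rule has_Delta_radial_eigenfunction[OF n])
  moreover have "has_Delta (radial_eigenfunction \<beta> :: real^'n \<Rightarrow> complex) 0 (\<gamma> * radial_eigenfunction \<gamma> (0::real^'n))"
    unfolding eq by (rule has_Delta_radial_eigenfunction[OF n])
  ultimately show ?thesis using has_Delta_unique by fastforce
qed

lemma cnj_hyp0F1:
  assumes "c \<ge> 1"
  shows "cnj (hyp0F1 c s) = hyp0F1 c (cnj s)"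
  unfolding hyp0F1_def bounded_linear.suminf[OF bounded_linear_cnj summable_hyp0F1_coeff[OF assms]]
  by (simp add: hyp0F1_coeff_def)

lemma cnj_radial_eigenfunction:
  fixes x :: "real^'n"
  assumes "CARD('n) > 1"
  shows "cnj (radial_eigenfunction \<beta> x) = radial_eigenfunction (cnj \<beta>) x"
  using assms by (simp add: radial_eigenfunction_def cnj_hyp0F1)

text \<open>All terms are nonnegative, and the first two already give 1 + s/c.\<close>

lemma Re_hyp0F1_gt_1:
  assumes c: "c \<ge> 1" and s: "s > 0"
  shows "Re (hyp0F1 c (complex_of_real s)) > 1"
proof -
  let ?a = "\<lambda>j. s ^ j / (fact j * pochhammer c j)"
  have eq: "hyp0F1_coeff c j * complex_of_real s ^ j = complex_of_real (?a j)" for j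
    by (simp add: hyp0F1_coeff_def)
  have "summable ?a"
    using summable_hyp0F1_coeff[OF c, of "complex_of_real s"] unfolding eq summable_of_real_iff .
  moreover have "?a j \<ge> 0" for j
  proof -
    have "pochhammer c j \<ge> 1" by (rule pochhammer_ge_1[OF c])
    then show ?thesis using s by simp
  qed
  ultimately have "(\<Sum>j<2. ?a j) \<le> suminf ?a" by (intro sum_le_suminf) auto
  moreover have "(\<Sum>j<2. ?a j) > 1"
    using c s by (simp add: numeral_2_eq_2)
  moreover have "hyp0F1 c (complex_of_real s) = complex_of_real (suminf ?a)"
    unfolding hyp0F1_def eq by (rule suminf_of_real[OF \<open>summable ?a\<close>, symmetric])
  ultimately show ?thesis by simp
qed

lemma bform_cvec: "bform (cvec x) (cvec y) = complex_of_real (x \<bullet> y)"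
  by (simp add: bform_def cvec_def inner_vec_def)

lemma cmat_cvec: "cmat k *v cvec x = cvec (k *v x)"
  by (simp add: vec_eq_iff cmat_def cvec_def matrix_vector_mult_def)

context transitive_pair
begin

lemma lift_phi_inv_mult:
  assumes "g \<in> carrier (motion_group K)" "h \<in> carrier (motion_group K)"
  shows "lift (phi \<mu> \<xi>) (inv\<^bsub>motion_group K\<^esub> h \<otimes>\<^bsub>motion_group K\<^esub> g) = phi \<mu> \<xi> (fst g - fst h)"
proof -
  obtain x k y l where gh: "g = (x, k)" "h = (y, l)" "k \<in> K" "l \<in> K" using assms by auto
  have "\<forall>x y. norm x = norm y \<longrightarrow> phi \<mu> \<xi> x = phi \<mu> \<xi> y" using phi_radial by blast
  from lift_inv_mult[OF this gh(4), of y x k] show ?thesis by (simp add: gh del: motion_group_simps)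
qed

text \<open>For a real frequency the plane waves are unitary characters, e(x - y) = e(x) times the
  conjugate of e(y). The quadratic form is then the integral over \<open>K\<close> of a squared
  modulus.\<close>

lemma positive_definite_phi:
  "positive_definite (motion_group K) (lift (phi \<mu> (cvec v)))"
  unfolding positive_definite_def
proof (intro allI impI)
  fix N :: nat and g :: "nat \<Rightarrow> (real^'n) \<times> (real^'n^'n)" and c :: "nat \<Rightarrow> complex"
  assume g: "\<forall>i<N. g i \<in> carrier (motion_group K)"
  let ?e = "\<lambda>x k. exp (\<i> * complex_of_real (x \<bullet> (k *v v)))"
  have phi: "phi \<mu> (cvec v) x = (\<integral>k. ?e x k \<partial>\<mu>)" for x
    by (simp add: phi_def cmat_cvec bform_cvec)
  have cont [continuous_intros]: "continuous_on K (\<lambda>k. ?e x k)" for x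
    by (intro continuous_intros) (simp add: matrix_vector_mult_def continuous_intros)
  have e_diff: "?e (x - y) k = ?e x k * cnj (?e y k)" for x y k
    by (simp add: exp_cnj inner_diff_left right_diff_distrib exp_diff exp_minus divide_inverse)
  have "(\<Sum>i<N. \<Sum>j<N. lift (phi \<mu> (cvec v))
      (inv\<^bsub>motion_group K\<^esub> g j \<otimes>\<^bsub>motion_group K\<^esub> g i) * cnj (c j) * c i) =
      (\<Sum>i<N. \<Sum>j<N. (\<integral>k. ?e (fst (g i)) k * cnj (?e (fst (g j)) k) * cnj (c j) * c i \<partial>\<mu>))"
    using g by (intro sum.cong refl) (simp add: lift_phi_inv_mult phi e_diff del: motion_group_simps)
  also have "\<dots> = (\<integral>k. (\<Sum>i<N. \<Sum>j<N. ?e (fst (g i)) k * cnj (?e (fst (g j)) k) * cnj (c j) * c i) \<partial>\<mu>)"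
    by (subst Bochner_Integration.integral_sum Bochner_Integration.integral_sum[symmetric];
        (intro integrable_\<mu>_continuous continuous_intros sum.cong refl)?)+
  also have "\<dots> = (\<integral>k. complex_of_real ((norm (\<Sum>i<N. c i * ?e (fst (g i)) k))\<^sup>2) \<partial>\<mu>)"
  proof (rule Bochner_Integration.integral_cong[OF refl])
    fix k
    have "complex_of_real ((norm (\<Sum>i<N. c i * ?e (fst (g i)) k))\<^sup>2) =
        (\<Sum>i<N. c i * ?e (fst (g i)) k) * cnj (\<Sum>i<N. c i * ?e (fst (g i)) k)"
      by (rule complex_norm_square)
    also have "\<dots> = (\<Sum>i<N. \<Sum>j<N. ?e (fst (g i)) k * cnj (?e (fst (g j)) k) * cnj (c j) * c i)"
      by (simp add: sum_product cnj_sum mult_ac del: exp_cnj)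
    finally show "(\<Sum>i<N. \<Sum>j<N. ?e (fst (g i)) k * cnj (?e (fst (g j)) k) * cnj (c j) * c i) =
        complex_of_real ((norm (\<Sum>i<N. c i * ?e (fst (g i)) k))\<^sup>2)" by simp
  qed
  also have "\<dots> = complex_of_real (\<integral>k. (norm (\<Sum>i<N. c i * ?e (fst (g i)) k))\<^sup>2 \<partial>\<mu>)"
    by (rule integral_complex_of_real)
  also have "\<dots> \<in> \<real>\<^sub>\<ge>\<^sub>0"
    unfolding nonneg_Reals_of_real_iff by (intro integral_nonneg_AE) simp
  finally show "(\<Sum>i<N. \<Sum>j<N. lift (phi \<mu> (cvec v))
      (inv\<^bsub>motion_group K\<^esub> g j \<otimes>\<^bsub>motion_group K\<^esub> g i) * cnj (c j) * c i) \<in> \<real>\<^sub>\<ge>\<^sub>0" .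
qed

text \<open>Test on the two translations by x and 0 with coefficients s = 1 or -1 and 1. As
  \<open>phi\<close> is even, the form is 2 + 2 s \<open>phi\<close>(x); its being real and
  nonnegative for both signs gives the claims.\<close>

lemma positive_definite_phi_bound:
  assumes "positive_definite (motion_group K) (lift (phi \<mu> \<xi>))"
  shows "phi \<mu> \<xi> x \<in> \<real>" "Re (phi \<mu> \<xi> x) \<le> 1"
proof -
  have sign: "2 + 2 * (s * phi \<mu> \<xi> x) \<in> \<real>\<^sub>\<ge>\<^sub>0" if s: "s = 1 \<or> s = -1" for s
  proof -
    let ?g = "\<lambda>i::nat. (if i = 0 then x else 0, mat 1 :: real^'n^'n)"
    let ?c = "\<lambda>i::nat. if i = 0 then s else 1"
    have g: "?g i \<in> carrier (motion_group K)" for i using one_K by simp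
    have "(\<Sum>i<2. \<Sum>j<2. lift (phi \<mu> \<xi>) (inv\<^bsub>motion_group K\<^esub> ?g j \<otimes>\<^bsub>motion_group K\<^esub> ?g i) *
        cnj (?c j) * ?c i) \<in> \<real>\<^sub>\<ge>\<^sub>0"
      by (rule assms[unfolded positive_definite_def, rule_format, of 2 ?g ?c]) (rule g)
    then have "(\<Sum>i<2. \<Sum>j<2. phi \<mu> \<xi> (fst (?g i) - fst (?g j)) * cnj (?c j) * ?c i) \<in> \<real>\<^sub>\<ge>\<^sub>0"
      by (simp only: lift_phi_inv_mult[OF g g])
    moreover have "phi \<mu> \<xi> (- x) = phi \<mu> \<xi> x" by (rule phi_radial) simp
    ultimately show ?thesis
      using s by (auto simp: numeral_2_eq_2 lessThan_Suc algebra_simps)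
  qed
  have "2 + 2 * phi \<mu> \<xi> x \<in> \<real>\<^sub>\<ge>\<^sub>0" "2 - 2 * phi \<mu> \<xi> x \<in> \<real>\<^sub>\<ge>\<^sub>0"
    using sign[of 1] sign[of "-1"] by simp_all
  then show "phi \<mu> \<xi> x \<in> \<real>" "Re (phi \<mu> \<xi> x) \<le> 1"
    by (auto simp: complex_nonneg_Reals_iff complex_is_Real_iff)
qed

lemma positive_definite_phi_iff:
  "positive_definite (motion_group K) (lift (phi \<mu> \<xi>)) \<longleftrightarrow> bform \<xi> \<xi> \<in> \<real>\<^sub>\<ge>\<^sub>0"
proof
  assume "bform \<xi> \<xi> \<in> \<real>\<^sub>\<ge>\<^sub>0"
  then obtain b where b: "bform \<xi> \<xi> = complex_of_real b" "b \<ge> 0"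
    by (metis complex_nonneg_Reals_iff complex_is_Real_iff of_real_Re)
  obtain a :: 'n where True by blast
  have "bform (cvec (sqrt b *\<^sub>R axis a 1)) (cvec (sqrt b *\<^sub>R axis a 1)) = bform \<xi> \<xi>"
    using b by (simp add: bform_cvec inner_axis_axis flip: of_real_mult)
  then have "phi \<mu> (cvec (sqrt b *\<^sub>R axis a 1)) = phi \<mu> \<xi>"
    by (simp add: phi_eq)
  then show "positive_definite (motion_group K) (lift (phi \<mu> \<xi>))"
    using positive_definite_phi by metis
next
  assume pd: "positive_definite (motion_group K) (lift (phi \<mu> \<xi>))"
  let ?\<beta> = "bform \<xi> \<xi>"
  have c: "real CARD('n) / 2 \<ge> 1" using card_gt_1 by simp
  have "radial_eigenfunction (cnj ?\<beta>) x = radial_eigenfunction ?\<beta> x" for x :: "real^'n"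
    using positive_definite_phi_bound(1)[OF pd, of x]
    unfolding phi_eq cnj_radial_eigenfunction[OF card_gt_1, symmetric] by (simp add: Reals_cnj_iff)
  then have "cnj ?\<beta> = ?\<beta>"
    by (intro radial_eigenfunction_inj[OF card_gt_1]) (rule ext)
  then obtain b where b: "?\<beta> = complex_of_real b"
    by (metis Reals_cnj_iff Reals_cases)
  have "b \<ge> 0"
  proof (rule ccontr)
    assume "\<not> b \<ge> 0"
    \<comment> \<open>\<open>- b / 4\<close> is the argument of the series at a vector of norm
      1.\<close>
    then have "Re (hyp0F1 (real CARD('n) / 2) (complex_of_real (- b / 4))) > 1"
      by (intro Re_hyp0F1_gt_1 c) simp
    moreover obtain a :: 'n where True by blast
    ultimately have "Re (phi \<mu> \<xi> (axis a 1)) > 1"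
      by (simp add: phi_eq radial_eigenfunction_def b)
    then show False using positive_definite_phi_bound(2)[OF pd, of "axis a 1"] by simp
  qed
  then show "?\<beta> \<in> \<real>\<^sub>\<ge>\<^sub>0" by (simp add: b)
qed

end

section \<open>Parametrization and explicit formulas\<close>

lemma ex_bform_eq: "\<exists>\<xi> :: complex^'n. bform \<xi> \<xi> = \<beta>"
proof -
  obtain a :: 'n where True by blast
  have "bform (axis a (csqrt \<beta>)) (axis a (csqrt \<beta>)) = (csqrt \<beta>)\<^sup>2"
    by (simp add: bform_def axis_def power2_eq_square if_distrib if_distribR sum.delta cong: if_cong)
  then show ?thesis by (metis power2_csqrt)
qed

context transitive_pair
begin

lemma range_phi: "range (phi \<mu>) = range radial_eigenfunction"
proof -
  have "radial_eigenfunction \<beta> \<in> range (phi \<mu>)" for \<beta>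
    using ex_bform_eq[of \<beta>] by (metis phi_eq rangeI)
  then show ?thesis by (auto simp: phi_eq)
qed

lemma spherical_functions_eq: "spherical_functions K \<mu> = range (phi \<mu>)"
proof
  show "spherical_functions K \<mu> \<subseteq> range (phi \<mu>)"
    unfolding range_phi spherical_functions_def
    using spherical_eq_radial_eigenfunction by blast
  show "range (phi \<mu>) \<subseteq> spherical_functions K \<mu>"
    unfolding spherical_functions_def using spherical_phi by blast
qed

text \<open>With \<nu> + 1 = n/2 the series of both sides agree, and \<open>z\<close> enters only
  through its square. The prefactor is the reciprocal of the value of \<open>bessel_J_quot\<close>
  at 0.\<close>

lemma phi_eq_bessel:
  assumes "z\<^sup>2 = bform \<xi> \<xi>"
  shows "phi \<mu> \<xi> x =
    complex_of_real (2 powr ((real CARD('n) - 2) / 2) * Gamma (real CARD('n) / 2))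
      * bessel_J_quot ((real CARD('n) - 2) / 2) (z * complex_of_real (norm x))"
proof -
  let ?\<nu> = "(real CARD('n) - 2) / 2"
  have \<nu>: "?\<nu> \<ge> 0" "?\<nu> + 1 = real CARD('n) / 2" using card_gt_1 by (simp_all add: field_simps)
  have G: "Gamma (real CARD('n) / 2) > 0" using card_gt_1 by (intro Gamma_real_pos) simp
  have "- (z * complex_of_real (norm x))\<^sup>2 / 4 = - bform \<xi> \<xi> * complex_of_real ((norm x)\<^sup>2) / 4"
    by (simp add: power_mult_distrib assms)
  then have "bessel_J_quot ?\<nu> (z * complex_of_real (norm x)) =
      complex_of_real (2 powr (- ?\<nu>) / Gamma (real CARD('n) / 2)) * phi \<mu> \<xi> x"
    by (simp only: bessel_J_quot_eq[OF \<nu>(1)] \<nu>(2) phi_eq radial_eigenfunction_def)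
  moreover have "2 powr ?\<nu> * Gamma (real CARD('n) / 2) * (2 powr (- ?\<nu>) / Gamma (real CARD('n) / 2)) = 1"
  proof -
    have cancel: "P * A * (inverse P / A) = 1" if "P > 0" "A > 0" for P A :: real
      using that by simp
    show ?thesis unfolding powr_minus by (rule cancel[OF _ G]) simp
  qed
  ultimately show ?thesis
    by (metis (no_types, lifting) mult.assoc mult_1 of_real_1 of_real_mult)
qed

text \<open>The case p = n - 2 of the Poisson integral, where (p + 2)/2 = n/2; the prefactor is the
  reciprocal of the moment of sin^(n-2).\<close>

lemma phi_eq_Poisson:
  assumes "z\<^sup>2 = bform \<xi> \<xi>"
  shows "phi \<mu> \<xi> x =
    complex_of_real (pi powr (- 1 / 2) * Gamma (real CARD('n) / 2) / Gamma ((real CARD('n) - 1) / 2))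
      * integral {0..pi} (\<lambda>\<theta>. cos (z * complex_of_real (norm x * cos \<theta>))
                                * complex_of_real (sin \<theta> ^ (CARD('n) - 2)))"
proof -
  define p where "p = CARD('n) - 2"
  have p: "CARD('n) = p + 2" using card_gt_1 by (simp add: p_def)
  have G: "Gamma (real CARD('n) / 2) > 0" "Gamma ((real CARD('n) - 1) / 2) > 0"
    using card_gt_1 by (intro Gamma_real_pos; simp)+
  have moment: "cos_sin_moment 0 p = sqrt pi * Gamma ((real CARD('n) - 1) / 2) / Gamma (real CARD('n) / 2)"
    unfolding sin_moment_eq p by (simp add: add_divide_distrib add.commute)
  have "- (z * complex_of_real (norm x))\<^sup>2 / 4 = - bform \<xi> \<xi> * complex_of_real ((norm x)\<^sup>2) / 4"
    by (simp add: power_mult_distrib assms)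
  then have "integral {0..pi} (\<lambda>\<theta>. cos (z * complex_of_real (norm x) * complex_of_real (cos \<theta>))
      * complex_of_real (sin \<theta> ^ p)) = complex_of_real (cos_sin_moment 0 p) * phi \<mu> \<xi> x"
    by (simp only: Poisson_integral[of "real CARD('n) / 2" p, unfolded p, OF refl] phi_eq
        radial_eigenfunction_def p)
  then have "integral {0..pi} (\<lambda>\<theta>. cos (z * complex_of_real (norm x * cos \<theta>))
      * complex_of_real (sin \<theta> ^ (CARD('n) - 2))) = complex_of_real (cos_sin_moment 0 p) * phi \<mu> \<xi> x"
    by (simp only: of_real_mult mult.assoc p_def)
  moreover have "pi powr (- 1 / 2) * Gamma (real CARD('n) / 2) / Gamma ((real CARD('n) - 1) / 2) *
      cos_sin_moment 0 p = 1"
  proof -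
    have "pi powr (- 1 / 2) = inverse (sqrt pi)"
      using powr_minus[of pi "1 / 2"] by (simp add: powr_half_sqrt)
    moreover have "inverse S * A / B * (S * B / A) = 1" if "S > 0" "A > 0" "B > 0" for S A B :: real
      using that by simp
    ultimately show ?thesis unfolding moment using G pi_gt_zero real_sqrt_gt_zero by metis
  qed
  ultimately show ?thesis
    by (metis (no_types, lifting) mult.assoc mult_1 of_real_1 of_real_mult)
qed

end

theorem theorem6p6:
  fixes K :: "(real^'n^'n) set" and \<mu> :: "(real^'n^'n) measure"
  assumes "CARD('n) > 1"
    and "closed K" and "subgroup K orthogonal_group"
    and "transitive_on_spheres K"
    and "haar_probability K \<mu>"
  shows
    "spherical_functions K \<mu> = range (phi \<mu>)
     \<and> (\<exists>param. bij_betw param (spherical_functions K \<mu>) (UNIV :: complex set)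
          \<and> (\<forall>\<xi>. param (phi \<mu> \<xi>) = bform \<xi> \<xi>)
          \<and> (\<forall>\<psi> \<in> spherical_functions K \<mu>.
               positive_definite (motion_group K) (lift \<psi>) \<longleftrightarrow> param \<psi> \<in> \<real>\<^sub>\<ge>\<^sub>0))
     \<and> (\<forall>\<xi> x. has_Delta (phi \<mu> \<xi>) x (bform \<xi> \<xi> * phi \<mu> \<xi> x))
     \<and> (\<forall>K' \<mu>'. closed K' \<and> subgroup K' orthogonal_group \<and> transitive_on_spheres K'
            \<and> haar_probability K' \<mu>' \<and> listed K \<and> listed K'
          \<longrightarrow> (\<forall>\<xi>. phi \<mu>' \<xi> = phi \<mu> \<xi>))
     \<and> (\<forall>\<xi> z x. z\<^sup>2 = bform \<xi> \<xi> \<longrightarrow>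
          phi \<mu> \<xi> x =
            complex_of_real (2 powr ((real CARD('n) - 2) / 2) * Gamma (real CARD('n) / 2))
              * bessel_J_quot ((real CARD('n) - 2) / 2) (z * complex_of_real (norm x))
        \<and> phi \<mu> \<xi> x =
            complex_of_real (pi powr (- 1 / 2) * Gamma (real CARD('n) / 2)
                             / Gamma ((real CARD('n) - 1) / 2))
              * integral {0..pi} (\<lambda>\<theta>. cos (z * complex_of_real (norm x * cos \<theta>))
                                        * complex_of_real (sin \<theta> ^ (CARD('n) - 2))))"
proof -
  interpret transitive_pair K \<mu>
    by (rule transitive_pair.intro[OF assms])
  \<comment> \<open>Taking the inverse of \<beta> -> h_\<beta>, instead of choosing a \<xi> for each
    function, makes the parameter well defined from the start.\<close>
  define param :: "(real^'n \<Rightarrow> complex) \<Rightarrow> complex" where "param = inv_into UNIV radial_eigenfunction"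
  have inj: "inj (radial_eigenfunction :: complex \<Rightarrow> real^'n \<Rightarrow> complex)"
    by (rule injI) (rule radial_eigenfunction_inj[OF assms(1)])
  have param_phi: "param (phi \<mu> \<xi>) = bform \<xi> \<xi>" for \<xi>
    unfolding param_def phi_eq by (rule inv_f_f[OF inj])
  have bij: "bij_betw param (spherical_functions K \<mu>) UNIV"
    unfolding spherical_functions_eq range_phi param_def
    by (intro bij_betw_inv_into inj_on_imp_bij_betw inj)
  have pd: "positive_definite (motion_group K) (lift \<psi>) \<longleftrightarrow> param \<psi> \<in> \<real>\<^sub>\<ge>\<^sub>0"
    if \<psi>: "\<psi> \<in> spherical_functions K \<mu>" for \<psi>
  proof -
    obtain \<xi> where "\<psi> = phi \<mu> \<xi>" using \<psi> unfolding spherical_functions_eq by blast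
    then show ?thesis by (simp only: param_phi positive_definite_phi_iff)
  qed
  have indep: "phi \<mu>' \<xi> = phi \<mu> \<xi>"
    if "closed K'" "subgroup K' orthogonal_group" "transitive_on_spheres K'" "haar_probability K' \<mu>'"
    for K' \<mu>' \<xi>
  proof -
    interpret K': transitive_pair K' \<mu>'
      by (rule transitive_pair.intro[OF assms(1) that])
    show ?thesis unfolding phi_eq K'.phi_eq ..
  qed
  show ?thesis
  proof (intro conjI exI[of _ param] allI impI ballI)
    fix K' :: "(real^'n^'n) set" and \<mu>' and \<xi> :: "complex^'n"
    assume "closed K' \<and> subgroup K' orthogonal_group \<and> transitive_on_spheres K'
      \<and> haar_probability K' \<mu>' \<and> listed K \<and> listed K'"
    then show "phi \<mu>' \<xi> = phi \<mu> \<xi>" by (intro indep; elim conjE)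
  qed (rule spherical_functions_eq bij param_phi pd has_Delta_phi phi_eq_bessel phi_eq_Poisson; assumption)+
qed

end
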